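(* In the constant-power network, let $\theta>0$ be a constant and $\epsilon'_\theta=\sqrt{\frac{2\theta\ln m}{E[C_0]}}$, where $E[C_0]=m\bar C$. Then, for $n$ sufficiently large, $$\Pr\big(C_{s,\mathcal T}\ge(1-\epsilon'_\theta)E[C_0]\big)=1-O\Big(\frac{l}{m^{\theta}}\Big)$$ as $m\to\infty$.
   Context: Model: nodes $1,\dots,n$ have locations i.i.d. uniform on the two-dimensional unit torus; $d_{ij}$ is the distance between nodes $i$ and $j$. The attenuation function $L:[0,\infty)\to[0,1]$ is continuous and strictly decreasing. Noise $N_0>0$, threshold $\beta>0$, interference factor $\gamma\in[0,1]$; all nodes transmit with constant power $P_0>\beta N_0$. The SINR of link $(i,j)$ is $\beta_{ij}=\frac{L(d_{ij})}{N_0/P_0+\gamma\sum_{k\neq i,j}L(d_{kj})}$ and the link capacity is $C_{ij}=R$ if $\beta_{ij}\ge\beta$, else $0$, for a constant $0<R\le1$. Fix distinct nodes: a source $s$, destinations $\mathcal T=\{t_1,\dots,t_l\}$, relays $u_1,\dots,u_m$, with no direct links considered between $s$ and the destinations. For $t\in\mathcal T$, an $s$-$t$-cut of size $k$ ($0\le k\le m$) is a partition of the relays into $V_k$ ($|V_k|=k$) and $V_k^c$ ($|V_k^c|=m-k$), with capacity $C_k=\sum_{u_i\in V_k^c}C_{s u_i}+\sum_{u_j\in V_k}\sum_{u_i\in V_k^c}C_{u_j u_i}+\sum_{u_j\in V_k}C_{u_j t}$. $C_{s,t}$ is the minimum of $C_k$ over all $s$-$t$-cuts of all sizes, and the network coding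 capacity is $C_{s,\mathcal T}=\min_{t\in\mathcal T}C_{s,t}$. $\bar C=E[C_{ij}]$ ($i\ne j$, expectation over locations), so $E[C_k]=[m+k(m-k)]\bar C$ and $E[C_0]=m\bar C$. *)

theory Defs
  imports "HOL-Probability.Probability"
begin

text \<open>Distance on the two-dimensional unit torus; points are represented in [0,1) x [0,1).\<close>
definition torus_dist :: "real \<times> real \<Rightarrow> real \<times> real \<Rightarrow> real" where
  "torus_dist x y =
     (let a = \<bar>fst x - fst y\<bar>; b = \<bar>snd x - snd y\<bar>
      in sqrt ((min a (1 - a))\<^sup>2 + (min b (1 - b))\<^sup>2))"

definition sinr :: "(real \<Rightarrow> real) \<Rightarrow> real \<Rightarrow> real \<Rightarrow> real \<Rightarrow> nat \<Rightarrow> (nat \<Rightarrow> real \<times> real) \<Rightarrow> nat \<Rightarrow> nat \<Rightarrow> real" where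
  "sinr L N0 P0 \<gamma> n x i j =
     L (torus_dist (x i) (x j)) /
     (N0 / P0 + \<gamma> * (\<Sum>k\<in>{..<n} - {i, j}. L (torus_dist (x k) (x j))))"

definition link_cap :: "(real \<Rightarrow> real) \<Rightarrow> real \<Rightarrow> real \<Rightarrow> real \<Rightarrow> real \<Rightarrow> real \<Rightarrow> nat \<Rightarrow> (nat \<Rightarrow> real \<times> real) \<Rightarrow> nat \<Rightarrow> nat \<Rightarrow> real" where
  "link_cap L N0 P0 \<gamma> \<beta> R n x i j = (if sinr L N0 P0 \<gamma> n x i j \<ge> \<beta> then R else 0)"

definition cut_cap :: "(nat \<Rightarrow> nat \<Rightarrow> real) \<Rightarrow> nat \<Rightarrow> nat \<Rightarrow> nat set \<Rightarrow> nat set \<Rightarrow> real" where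
  "cut_cap C s t U V =
     (\<Sum>u\<in>U - V. C s u) + (\<Sum>v\<in>V. \<Sum>u\<in>U - V. C v u) + (\<Sum>v\<in>V. C v t)"

definition st_cap :: "(nat \<Rightarrow> nat \<Rightarrow> real) \<Rightarrow> nat \<Rightarrow> nat \<Rightarrow> nat set \<Rightarrow> real" where
  "st_cap C s t U = Min ((\<lambda>V. cut_cap C s t U V) ` Pow U)"

definition net_cap :: "(nat \<Rightarrow> nat \<Rightarrow> real) \<Rightarrow> nat \<Rightarrow> nat set \<Rightarrow> nat set \<Rightarrow> real" where
  "net_cap C s T U = Min ((\<lambda>t. st_cap C s t U) ` T)"

definition node_space :: "nat \<Rightarrow> (nat \<Rightarrow> real \<times> real) measure" where
  "node_space n = PiM {..<n} (\<lambda>_. uniform_measure lborel ({0..<1::real} \<times> {0..<1::real}))"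

end

theory Submission
  imports Defs
begin

text \<open>
  If \<open>\<gamma> > 0\<close>, the interference grows linearly in \<open>n\<close> because \<open>L\<close> is bounded away from \<open>0\<close> on the
  torus; so for large \<open>n\<close> almost surely no link exists, all capacities vanish and there is nothing to
  prove. If \<open>\<gamma> = 0\<close>, links form a random geometric graph on the torus. A link exists with the same
  probability \<open>p\<close> whatever the position of one of its ends, so the degree of a terminal into the
  relays is binomial and the multiplicative Chernoff bound gives degree at least
  \<open>(1 - eps) * m * p\<close> except with probability \<open>m powr (- \<theta>)\<close>.

  A union bound over the \<open>2 ^ m\<close> dependent cuts is avoided: cut the torus into a fixed number of small
  cells. Except with exponentially small probability every cell receives linearly many relays, and
  then every cut has at least as many links as the smallest of the degree of \<open>s\<close>, the degree of \<open>t\<close>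
  and \<open>m\<close>. The union bound is needed only over \<open>s\<close>, the destinations and the cells.
\<close>

section \<open>A Chernoff bound for degrees in random geometric graphs\<close>

text \<open>With coordinate \<open>s\<close> fixed at \<open>y\<close>, the coordinates in
  \<open>U\<close> are independent, so the integral of the product is a product of inner integrals,
  each equal to \<open>c\<close> for almost every \<open>y\<close>. The outer integral is then that
  of a constant. Asking for \<open>c\<close> only almost everywhere fits the torus, where
  homogeneity holds for centres in the unit square.\<close>

lemma nn_integral_PiM_star:
  fixes M :: "'a measure" and g :: "'a \<Rightarrow> 'a \<Rightarrow> ennreal"
  assumes "prob_space M" "finite I" "s \<in> I" "U \<subseteq> I" "s \<notin> U"
    and g: "(\<lambda>(y, z). g y z) \<in> borel_measurable (M \<Otimes>\<^sub>M M)"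
    and c: "AE y in M. (\<integral>\<^sup>+z. g y z \<partial>M) = c"
  shows "(\<integral>\<^sup>+x. (\<Prod>u\<in>U. g (x s) (x u)) \<partial>PiM I (\<lambda>_. M)) = c ^ card U"
proof -
  interpret M: prob_space M by fact
  interpret product_sigma_finite "\<lambda>_. M" ..
  define J where "J = I - {s}"
  have J: "finite J" "s \<notin> J" "I = insert s J" "U \<subseteq> J"
    using assms by (auto simp: J_def)
  have [measurable]: "(\<lambda>x. g (x s) (x u)) \<in> borel_measurable (PiM I (\<lambda>_. M))" if "u \<in> U" for u
  proof -
    have "(\<lambda>x. (x s, x u)) \<in> measurable (PiM I (\<lambda>_. M)) (M \<Otimes>\<^sub>M M)"
      using that \<open>U \<subseteq> I\<close> \<open>s \<in> I\<close> by (intro measurable_Pair measurable_component_singleton) auto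
    from measurable_compose[OF this g] show ?thesis by simp
  qed
  have "(\<integral>\<^sup>+x. (\<Prod>u\<in>U. g (x s) (x u)) \<partial>PiM I (\<lambda>_. M)) =
      (\<integral>\<^sup>+y. (\<integral>\<^sup>+x. (\<Prod>u\<in>U. g ((x(s := y)) s) ((x(s := y)) u)) \<partial>PiM J (\<lambda>_. M)) \<partial>M)"
    unfolding J(3) using J by (subst product_nn_integral_insert_rev) (simp_all flip: J(3))
  also have "\<dots> = (\<integral>\<^sup>+y. c ^ card U \<partial>M)"
  proof (rule nn_integral_cong_AE, use c AE_space in eventually_elim)
    fix y assume y: "(\<integral>\<^sup>+z. g y z \<partial>M) = c" "y \<in> space M"
    have gy: "g y \<in> borel_measurable M"
      using measurable_Pair2[OF g y(2)] by simp
    \<comment> \<open>Padding with factors 1 outside \<open>U\<close> gives a product over all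
      remaining coordinates, the form to which the product rule applies.\<close>
    have "(\<integral>\<^sup>+x. (\<Prod>u\<in>U. g ((x(s := y)) s) ((x(s := y)) u)) \<partial>PiM J (\<lambda>_. M)) =
        (\<integral>\<^sup>+x. (\<Prod>u\<in>J. if u \<in> U then g y (x u) else 1) \<partial>PiM J (\<lambda>_. M))"
    proof (intro nn_integral_cong)
      fix x
      have "(\<Prod>u\<in>U. g ((x(s := y)) s) ((x(s := y)) u)) = (\<Prod>u\<in>U. g y (x u))"
        using \<open>s \<notin> U\<close> by (intro prod.cong) auto
      also have "\<dots> = (\<Prod>u\<in>J. if u \<in> U then g y (x u) else 1)"
        using J by (simp add: prod.If_cases Int_absorb1)
      finally show "(\<Prod>u\<in>U. g ((x(s := y)) s) ((x(s := y)) u)) = \<dots>" .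
    qed
    also have "\<dots> = (\<Prod>u\<in>J. \<integral>\<^sup>+z. (if u \<in> U then g y z else 1) \<partial>M)"
      using J gy by (intro product_nn_integral_prod[where f = "\<lambda>u z. if u \<in> U then g y z else 1"]) auto
    also have "\<dots> = (\<Prod>u\<in>J. if u \<in> U then c else 1)"
      by (intro prod.cong) (auto simp: y M.emeasure_space_1)
    also have "\<dots> = c ^ card U"
      using J by (simp add: prod.If_cases Int_absorb1)
    finally show "(\<integral>\<^sup>+x. (\<Prod>u\<in>U. g ((x(s := y)) s) ((x(s := y)) u)) \<partial>PiM J (\<lambda>_. M)) = c ^ card U" .
  qed
  also have "\<dots> = c ^ card U"
    by (simp add: M.emeasure_space_1)
  finally show ?thesis .
qed

text \<open>Multiplied by \<open>1 + x + x\<^sup>2 / 2\<close>, which is at most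
  \<open>exp x\<close>, the right-hand side becomes \<open>1 + (x\<^sup>2 / 2)\<^sup>2\<close>,
  hence at least 1.\<close>

lemma exp_minus_le_quadratic:
  fixes x :: real
  assumes "0 \<le> x"
  shows "exp (- x) \<le> 1 - x + x\<^sup>2 / 2"
proof -
  have nn: "0 \<le> 1 - x + x\<^sup>2 / 2"
    using sum_squares_ge_zero[of "1 - x" 1] by (simp add: power2_eq_square algebra_simps)
  have "1 \<le> 1 + (x\<^sup>2 / 2)\<^sup>2" by simp
  also have "\<dots> = (1 - x + x\<^sup>2 / 2) * (1 + x + x\<^sup>2 / 2)"
    by (simp add: power2_eq_square field_simps)
  also have "\<dots> \<le> (1 - x + x\<^sup>2 / 2) * exp x"
    by (rule mult_left_mono[OF exp_lower_Taylor_quadratic[OF assms] nn])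
  finally show ?thesis
    by (simp add: exp_minus field_simps)
qed

text \<open>The star formula for a single leaf, with an indicator as integrand. It supplies the mean
  capacity of one link.\<close>

lemma prob_PiM_pair:
  fixes M :: "'a measure" and A :: "'a \<Rightarrow> 'a \<Rightarrow> bool"
  assumes "prob_space M" "finite I" "s \<in> I" "u \<in> I" "s \<noteq> u"
    and A: "Measurable.pred (M \<Otimes>\<^sub>M M) (\<lambda>(y, z). A y z)"
    and p: "AE y in M. measure M {z \<in> space M. A y z} = p"
  shows "measure (PiM I (\<lambda>_. M)) {x \<in> space (PiM I (\<lambda>_. M)). A (x s) (x u)} = p"
proof -
  interpret M: prob_space M by fact
  let ?P = "PiM I (\<lambda>_. M)"
  have pair: "(\<lambda>x. (x s, x u)) \<in> measurable ?P (M \<Otimes>\<^sub>M M)"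
    using assms by (intro measurable_Pair measurable_component_singleton) auto
  have [measurable]: "{x \<in> space ?P. A (x s) (x u)} \<in> sets ?P"
    using measurable_compose[OF pair A] by (simp add: pred_def)
  define g where "g y z = (if A y z then 1 else 0 :: ennreal)" for y z
  have "AE y in M. (\<integral>\<^sup>+z. g y z \<partial>M) = ennreal p"
    using p AE_space
  proof eventually_elim
    case (elim y)
    have "Measurable.pred M (A y)"
      using measurable_Pair2[OF A elim(2)] by simp
    hence "{z \<in> space M. A y z} \<in> sets M" by simp
    hence "(\<integral>\<^sup>+z. indicator {z \<in> space M. A y z} z \<partial>M) = ennreal p"
      using elim(1) by (simp add: M.emeasure_eq_measure)
    also have "(\<integral>\<^sup>+z. indicator {z \<in> space M. A y z} z \<partial>M) = (\<integral>\<^sup>+z. g y z \<partial>M)"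
      by (intro nn_integral_cong) (auto simp: indicator_def g_def)
    finally show ?case .
  qed
  moreover have "(\<lambda>(y, z). g y z) \<in> borel_measurable (M \<Otimes>\<^sub>M M)"
  proof -
    have "(\<lambda>w. if (\<lambda>(y, z). A y z) w then 1 else 0 :: ennreal) \<in> borel_measurable (M \<Otimes>\<^sub>M M)"
      using A by measurable
    also have "(\<lambda>w. if (\<lambda>(y, z). A y z) w then 1 else 0) = (\<lambda>(y, z). g y z)"
      by (auto simp: fun_eq_iff g_def)
    finally show ?thesis .
  qed
  ultimately have "(\<integral>\<^sup>+x. (\<Prod>v\<in>{u}. g (x s) (x v)) \<partial>?P) = ennreal p ^ card {u}"
    using assms by (intro nn_integral_PiM_star) auto
  hence "(\<integral>\<^sup>+x. g (x s) (x u) \<partial>?P) = ennreal p"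
    by simp
  also have "(\<integral>\<^sup>+x. g (x s) (x u) \<partial>?P) = (\<integral>\<^sup>+x. indicator {x \<in> space ?P. A (x s) (x u)} x \<partial>?P)"
    by (intro nn_integral_cong) (auto simp: indicator_def g_def)
  also have "\<dots> = emeasure ?P {x \<in> space ?P. A (x s) (x u)}"
    by (rule nn_integral_indicator) measurable
  finally have "emeasure ?P {x \<in> space ?P. A (x s) (x u)} = ennreal p" .
  \<comment> \<open>\<open>ennreal\<close> truncates negative numbers, so the sign of
    \<open>p\<close> is needed to return to the real measure. It follows because \<open>p\<close> is
    the measure of some set for almost every \<open>y\<close>.\<close>
  moreover have "0 \<le> p"
  proof (rule ccontr)
    assume "\<not> 0 \<le> p"
    have "AE y in M. False"
      using p
    proof eventually_elim
      case (elim y)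
      then show False using \<open>\<not> 0 \<le> p\<close> measure_nonneg[of M "{z \<in> space M. A y z}"] by simp
    qed
    then show False by simp
  qed
  ultimately show ?thesis
    by (simp add: measure_def)
qed

text \<open>Conditionally on the position of \<open>s\<close> the edges at \<open>s\<close> are independent, and their probability \<open>p\<close>
  does not depend on that position.\<close>
lemma prob_star_degree_le:
  fixes M :: "'a measure" and A :: "'a \<Rightarrow> 'a \<Rightarrow> bool"
  assumes "prob_space M" "finite I" "s \<in> I" "U \<subseteq> I" "s \<notin> U"
    and A: "Measurable.pred (M \<Otimes>\<^sub>M M) (\<lambda>(y, z). A y z)"
    and p: "AE y in M. measure M {z \<in> space M. A y z} = p"
    and p01: "0 \<le> p" "p \<le> 1" and "0 \<le> \<delta>"
  shows "measure (PiM I (\<lambda>_. M)) {x \<in> space (PiM I (\<lambda>_. M)).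
      real (card {u\<in>U. A (x s) (x u)}) \<le> (1 - \<delta>) * (real (card U) * p)} \<le> exp (- (real (card U) * p * \<delta>\<^sup>2 / 2))"
proof -
  interpret M: prob_space M by fact
  let ?P = "PiM I (\<lambda>_. M)"
  interpret P: prob_space ?P by (rule prob_space_PiM) (rule assms(1))
  have finU: "finite U" using assms finite_subset by blast
  define \<mu> where "\<mu> = real (card U) * p"
  \<comment> \<open>The exponential moment is taken at parameter \<open>\<delta>\<close> itself
    rather than at the optimal one. This still yields the exponent
    \<open>\<delta>\<^sup>2 / 2\<close> and works for every \<open>\<delta> \<ge> 0\<close>,
    including values above 1.\<close>
  define g where "g y z = ennreal (exp (- \<delta> * of_bool (A y z)))" for y z
  define q where "q = 1 - p + p * exp (- \<delta>)"
  have g_meas: "(\<lambda>(y, z). g y z) \<in> borel_measurable (M \<Otimes>\<^sub>M M)"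
  proof -
    have "(\<lambda>w. ennreal (if (\<lambda>(y, z). A y z) w then exp (- \<delta>) else 1)) \<in> borel_measurable (M \<Otimes>\<^sub>M M)"
      using A by measurable
    also have "(\<lambda>w. ennreal (if (\<lambda>(y, z). A y z) w then exp (- \<delta>) else 1)) = (\<lambda>(y, z). g y z)"
      by (auto simp: fun_eq_iff g_def)
    finally show ?thesis .
  qed
  have g_int: "AE y in M. (\<integral>\<^sup>+z. g y z \<partial>M) = ennreal q"
    using p AE_space
  proof eventually_elim
    case (elim y)
    have "Measurable.pred M (A y)"
      using measurable_Pair2[OF A elim(2)] by simp
    hence [measurable]: "{z \<in> space M. A y z} \<in> sets M" by simp
    define B where "B = {z \<in> space M. A y z}"
    have [measurable]: "B \<in> sets M" by (simp add: B_def)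
    have "(\<integral>\<^sup>+z. g y z \<partial>M) = (\<integral>\<^sup>+z. ennreal (exp (- \<delta>)) * indicator B z + indicator (space M - B) z \<partial>M)"
      by (intro nn_integral_cong) (auto simp: g_def B_def indicator_def)
    also have "\<dots> = ennreal (exp (- \<delta>)) * emeasure M B + emeasure M (space M - B)"
      by (simp add: nn_integral_add nn_integral_cmult)
    also have "\<dots> = ennreal (exp (- \<delta>) * p + (1 - p))"
      using elim(1) p01
      by (simp add: M.emeasure_eq_measure M.prob_compl ennreal_mult flip: B_def)
    finally show ?case by (simp add: q_def algebra_simps)
  qed
  have q0: "0 \<le> q" using p01 by (simp add: q_def)
  have star: "(\<integral>\<^sup>+x. (\<Prod>u\<in>U. g (x s) (x u)) \<partial>?P) = ennreal q ^ card U"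
    using assms g_meas g_int by (intro nn_integral_PiM_star) auto
  define X where "X x = card {u\<in>U. A (x s) (x u)}" for x
  have prod_X: "(\<Prod>u\<in>U. g (x s) (x u)) = ennreal (exp (- \<delta> * X x))" for x
  proof -
    have "(\<Prod>u\<in>U. g (x s) (x u)) = ennreal (\<Prod>u\<in>U. exp (- \<delta> * of_bool (A (x s) (x u))))"
      unfolding g_def by (rule prod_ennreal) simp
    also have "(\<Prod>u\<in>U. exp (- \<delta> * of_bool (A (x s) (x u)))) = exp (\<Sum>u\<in>U. - \<delta> * of_bool (A (x s) (x u)))"
      using finU by (simp add: exp_sum)
    also have "(\<Sum>u\<in>U. - \<delta> * of_bool (A (x s) (x u))) = - \<delta> * real (X x)"
      using finU by (simp add: X_def sum_distrib_left[symmetric] of_bool_def sum.If_cases sum_negf Int_def)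
    finally show ?thesis .
  qed
  have q_le: "q \<le> exp (- (p * (1 - exp (- \<delta>))))"
    using exp_ge_add_one_self[of "- (p * (1 - exp (- \<delta>)))"] by (simp add: q_def algebra_simps)
  have meas: "(\<lambda>x. \<Prod>u\<in>U. g (x s) (x u)) \<in> borel_measurable ?P"
  proof (intro borel_measurable_prod_ennreal)
    fix u assume "u \<in> U"
    hence "(\<lambda>x. (x s, x u)) \<in> measurable ?P (M \<Otimes>\<^sub>M M)"
      using assms by (intro measurable_Pair measurable_component_singleton) auto
    from measurable_compose[OF this g_meas] show "(\<lambda>x. g (x s) (x u)) \<in> borel_measurable ?P" by simp
  qed
  let ?E = "{x \<in> space ?P. real (X x) \<le> (1 - \<delta>) * \<mu>}"
  \<comment> \<open>Markov's inequality for \<open>exp (- \<delta> * X)\<close>: a small degree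
    forces the rescaled exponential to be at least 1.\<close>
  have "emeasure ?P ?E \<le> emeasure ?P ({x \<in> space ?P. 1 \<le> ennreal (exp (\<delta> * ((1 - \<delta>) * \<mu>))) * (\<Prod>u\<in>U. g (x s) (x u))})"
  proof (rule emeasure_mono)
    show "?E \<subseteq> {x \<in> space ?P. 1 \<le> ennreal (exp (\<delta> * ((1 - \<delta>) * \<mu>))) * (\<Prod>u\<in>U. g (x s) (x u))}"
    proof safe
      fix x assume *: "real (X x) \<le> (1 - \<delta>) * \<mu>"
      have "ennreal (exp (\<delta> * ((1 - \<delta>) * \<mu>))) * (\<Prod>u\<in>U. g (x s) (x u)) = ennreal (exp (\<delta> * ((1 - \<delta>) * \<mu>) - \<delta> * X x))"
        by (simp add: prod_X ennreal_mult[symmetric] exp_add[symmetric])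
      moreover have "1 \<le> exp (\<delta> * ((1 - \<delta>) * \<mu>) - \<delta> * X x)"
        using mult_left_mono[OF * \<open>0 \<le> \<delta>\<close>] by simp
      ultimately show "1 \<le> ennreal (exp (\<delta> * ((1 - \<delta>) * \<mu>))) * (\<Prod>u\<in>U. g (x s) (x u))"
        by (simp add: ennreal_ge_1)
    qed
  qed (use meas in measurable)
  also have "\<dots> \<le> ennreal (exp (\<delta> * ((1 - \<delta>) * \<mu>))) * (\<integral>\<^sup>+x. (\<Prod>u\<in>U. g (x s) (x u)) * indicator (space ?P) x \<partial>?P)"
    by (rule nn_integral_Markov_inequality) (use meas in \<open>auto intro: borel_measurable_times_ennreal\<close>)
  also have "(\<integral>\<^sup>+x. (\<Prod>u\<in>U. g (x s) (x u)) * indicator (space ?P) x \<partial>?P) = (\<integral>\<^sup>+x. (\<Prod>u\<in>U. g (x s) (x u)) \<partial>?P)"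
    by (intro nn_integral_cong) simp
  also have "ennreal (exp (\<delta> * ((1 - \<delta>) * \<mu>))) * \<dots> = ennreal (exp (\<delta> * ((1 - \<delta>) * \<mu>)) * q ^ card U)"
    using q0 by (simp add: star ennreal_mult ennreal_power)
  finally have "measure ?P ?E \<le> exp (\<delta> * ((1 - \<delta>) * \<mu>)) * q ^ card U"
    using q0 by (simp add: P.emeasure_eq_measure)
  also have "\<dots> \<le> exp (\<delta> * ((1 - \<delta>) * \<mu>)) * exp (- (p * (1 - exp (- \<delta>)))) ^ card U"
    by (intro mult_left_mono power_mono q_le q0) simp
  also have "\<dots> = exp (\<mu> * (\<delta> * (1 - \<delta>) - 1 + exp (- \<delta>)))"
    by (simp add: \<mu>_def exp_of_nat_mult[symmetric] exp_add[symmetric] algebra_simps)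
  \<comment> \<open>Bounding \<open>exp (- \<delta>)\<close> by its quadratic majorant cancels the
    constant and linear terms and leaves \<open>- (\<delta>\<^sup>2 / 2)\<close>.\<close>
  also have "\<dots> \<le> exp (\<mu> * (- (\<delta>\<^sup>2 / 2)))"
    using exp_minus_le_quadratic[OF \<open>0 \<le> \<delta>\<close>] p01
    by (subst exp_le_cancel_iff, intro mult_left_mono) (simp_all add: \<mu>_def power2_eq_square algebra_simps)
  finally show ?thesis by (simp add: X_def \<mu>_def mult.assoc)
qed

section \<open>The uniform distribution on the torus\<close>

abbreviation unit_square :: "(real \<times> real) set" where
  "unit_square \<equiv> {0..<1} \<times> {0..<1}"

abbreviation torus_unif :: "(real \<times> real) measure" where
  "torus_unif \<equiv> uniform_measure lborel unit_square"

lemma emeasure_lborel_Times: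
  fixes A B :: "real set"
  assumes [measurable]: "A \<in> sets borel" "B \<in> sets borel"
  shows "emeasure lborel (A \<times> B) = emeasure lborel A * emeasure lborel B"
  unfolding lborel_prod[symmetric] by (rule lborel.emeasure_pair_measure_Times) auto

lemma emeasure_unit_square [simp]: "emeasure lborel unit_square = 1"
  by (subst emeasure_lborel_Times) auto

lemma sets_unit_square [measurable, simp]: "unit_square \<in> sets borel"
  by (intro borel_Times) auto

lemma prob_space_torus_unif: "prob_space torus_unif"
  by (rule prob_space_uniform_measure) auto

lemma AE_torus_unif: "AE y in torus_unif. y \<in> unit_square"
  by (rule AE_uniform_measureI) auto

lemma emeasure_torus_unif:
  assumes "B \<in> sets borel"
  shows "emeasure torus_unif B = (\<integral>\<^sup>+z. indicator B z * indicator unit_square z \<partial>lborel)"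
proof -
  have "emeasure torus_unif B = emeasure lborel (B \<inter> unit_square)"
    using assms by (simp add: Int_commute divide_ennreal_def)
  also have "\<dots> = (\<integral>\<^sup>+z. indicator (B \<inter> unit_square) z \<partial>lborel)"
    using assms by (intro nn_integral_indicator[symmetric]) auto
  finally show ?thesis by (simp add: indicator_inter_arith)
qed

section \<open>Translation invariance on the torus\<close>

lemma borel_measurable_frac [measurable]: "(frac :: real \<Rightarrow> real) \<in> borel_measurable borel"
  unfolding frac_def by measurable

text \<open>Rotation of the circle swaps two intervals: \<open>g\<close> is the part from
  \<open>y\<close> on, where nothing wraps, and \<open>h\<close> the part before \<open>y\<close>,
  which wraps around by 1.\<close>

lemma nn_integral_frac_shift:
  fixes f :: "real \<Rightarrow> ennreal"
  assumes [measurable]: "f \<in> borel_measurable borel" and y: "0 \<le> y" "y < 1"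
  shows "(\<integral>\<^sup>+z. f (frac (z - y)) * indicator {0..<1} z \<partial>lborel) = (\<integral>\<^sup>+z. f z * indicator {0..<1} z \<partial>lborel)"
proof -
  define g where "g z = f (z - y) * indicator {y..<1} z" for z
  define h where "h z = f (z - y + 1) * indicator {0..<y} z" for z
  have [measurable]: "g \<in> borel_measurable borel" "h \<in> borel_measurable borel"
    unfolding g_def h_def by measurable
  have "f (frac (z - y)) * indicator {0..<1} z = g z + h z" for z
  proof (cases "0 \<le> z \<and> z < 1")
    case True
    show ?thesis
    proof (cases "y \<le> z")
      case True
      then have "frac (z - y) = z - y" using \<open>0 \<le> z \<and> z < 1\<close> y by (subst frac_eq) auto
      then show ?thesis using \<open>0 \<le> z \<and> z < 1\<close> True by (simp add: g_def h_def)
    next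
      case False
      then have "frac (z - y) = z - y + 1" using \<open>0 \<le> z \<and> z < 1\<close> y
        by (subst frac_unique_iff) auto
      then show ?thesis using \<open>0 \<le> z \<and> z < 1\<close> False by (simp add: g_def h_def)
    qed
  qed (use y in \<open>auto simp: g_def h_def indicator_def\<close>)
  then have "(\<integral>\<^sup>+z. f (frac (z - y)) * indicator {0..<1} z \<partial>lborel) = (\<integral>\<^sup>+z. g z \<partial>lborel) + (\<integral>\<^sup>+z. h z \<partial>lborel)"
    by (simp add: nn_integral_add)
  \<comment> \<open>After translation the two pieces are supported on \<open>{0..<1 - y}\<close> and
    \<open>{1 - y..<1}\<close>, which together tile the unit interval.\<close>
  also have "(\<integral>\<^sup>+z. g z \<partial>lborel) = (\<integral>\<^sup>+z. g (y + z) \<partial>lborel)"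
    using nn_integral_real_affine[of g 1 y] by simp
  also have "(\<integral>\<^sup>+z. h z \<partial>lborel) = (\<integral>\<^sup>+z. h (y - 1 + z) \<partial>lborel)"
    using nn_integral_real_affine[of h 1 "y - 1"] by simp
  also have "(\<integral>\<^sup>+z. g (y + z) \<partial>lborel) + (\<integral>\<^sup>+z. h (y - 1 + z) \<partial>lborel) = (\<integral>\<^sup>+z. g (y + z) + h (y - 1 + z) \<partial>lborel)"
    by (rule nn_integral_add[symmetric]) measurable
  also have "\<dots> = (\<integral>\<^sup>+z. f z * indicator {0..<1} z \<partial>lborel)"
    using y by (intro nn_integral_cong) (auto simp: g_def h_def indicator_def)
  finally show ?thesis .
qed

text \<open>Fubini reduces this to two rotations of the circle, applied to the second coordinate and
  then to the first.\<close>

lemma nn_integral_torus_shift: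
  fixes F :: "real \<times> real \<Rightarrow> ennreal"
  assumes [measurable]: "F \<in> borel_measurable borel" and y: "y \<in> unit_square"
  shows "(\<integral>\<^sup>+z. F (frac (fst z - fst y), frac (snd z - snd y)) * indicator unit_square z \<partial>lborel) =
    (\<integral>\<^sup>+z. F z * indicator unit_square z \<partial>lborel)"
proof -
  have [measurable]: "F \<in> borel_measurable (borel \<Otimes>\<^sub>M borel)"
    by (simp add: borel_prod)
  have ind: "indicator unit_square z = (indicator {0..<1} (snd z) * indicator {0..<1} (fst z) :: ennreal)" for z
    by (simp add: indicator_times mult.commute)
  have iterated: "(\<integral>\<^sup>+z. G z * indicator unit_square z \<partial>lborel) =
      (\<integral>\<^sup>+a. (\<integral>\<^sup>+b. G (a, b) * indicator {0..<1} b \<partial>lborel) * indicator {0..<1} a \<partial>lborel)"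
    if [measurable]: "G \<in> borel_measurable (borel \<Otimes>\<^sub>M borel)" for G :: "real \<times> real \<Rightarrow> ennreal"
  proof -
    have "(\<integral>\<^sup>+z. G z * indicator unit_square z \<partial>lborel) =
        (\<integral>\<^sup>+z. G z * indicator {0..<1} (snd z) * indicator {0..<1} (fst z) \<partial>(lborel \<Otimes>\<^sub>M lborel))"
      by (simp add: ind lborel_prod mult.assoc)
    also have "\<dots> = (\<integral>\<^sup>+a. (\<integral>\<^sup>+b. G (a, b) * indicator {0..<1} b * indicator {0..<1} a \<partial>lborel) \<partial>lborel)"
      by (subst lborel.nn_integral_fst[symmetric]) simp_all
    also have "\<dots> = (\<integral>\<^sup>+a. (\<integral>\<^sup>+b. G (a, b) * indicator {0..<1} b \<partial>lborel) * indicator {0..<1} a \<partial>lborel)"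
      by (intro nn_integral_cong nn_integral_multc) measurable
    finally show ?thesis .
  qed
  have "(\<integral>\<^sup>+z. F (frac (fst z - fst y), frac (snd z - snd y)) * indicator unit_square z \<partial>lborel) =
     (\<integral>\<^sup>+a. (\<integral>\<^sup>+b. F (frac (a - fst y), frac (b - snd y)) * indicator {0..<1} b \<partial>lborel) * indicator {0..<1} a \<partial>lborel)"
    by (subst iterated) simp_all
  also have "\<dots> = (\<integral>\<^sup>+a. (\<integral>\<^sup>+b. F (frac (a - fst y), b) * indicator {0..<1} b \<partial>lborel) * indicator {0..<1} a \<partial>lborel)"
  proof (rule nn_integral_cong, rule arg_cong2[where f = "(*)", OF _ refl])
    fix a
    have "(\<lambda>b. F (frac (a - fst y), b)) \<in> borel_measurable borel" by measurable
    from nn_integral_frac_shift[OF this, of "snd y"] y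
    show "(\<integral>\<^sup>+b. F (frac (a - fst y), frac (b - snd y)) * indicator {0..<1} b \<partial>lborel) =
        (\<integral>\<^sup>+b. F (frac (a - fst y), b) * indicator {0..<1} b \<partial>lborel)"
      by auto
  qed
  also have "\<dots> = (\<integral>\<^sup>+a. (\<integral>\<^sup>+b. F (a, b) * indicator {0..<1} b \<partial>lborel) * indicator {0..<1} a \<partial>lborel)"
  proof -
    have "(\<lambda>a. \<integral>\<^sup>+b. F (a, b) * indicator {0..<1} b \<partial>lborel) \<in> borel_measurable borel" by measurable
    from nn_integral_frac_shift[OF this, of "fst y"] y show ?thesis by auto
  qed
  also have "\<dots> = (\<integral>\<^sup>+z. F z * indicator unit_square z \<partial>lborel)"
    by (subst iterated) simp_all
  finally show ?thesis .
qed

section \<open>Torus distance and homogeneity\<close>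

lemma torus_dist_nonneg [simp]: "0 \<le> torus_dist x y"
  by (simp add: torus_dist_def Let_def)

lemma torus_dist_commute: "torus_dist x y = torus_dist y x"
  by (simp add: torus_dist_def abs_minus_commute)

lemma torus_dist_measurable [measurable]:
  assumes [measurable]: "f \<in> measurable M borel" "g \<in> measurable M borel"
  shows "(\<lambda>x. torus_dist (f x) (g x)) \<in> borel_measurable M"
proof -
  have [measurable]: "f \<in> measurable M (borel \<Otimes>\<^sub>M borel)" "g \<in> measurable M (borel \<Otimes>\<^sub>M borel)"
    using assms by (simp_all add: borel_prod)
  show ?thesis unfolding torus_dist_def Let_def by measurable
qed

text \<open>Wrapping around replaces a coordinate difference \<open>t\<close> by
  \<open>1 - t\<close>, and \<open>min t (1 - t)\<close> does not notice this.\<close>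

lemma torus_dist_shift:
  assumes "y \<in> unit_square" "z \<in> unit_square"
  shows "torus_dist y z = torus_dist (0, 0) (frac (fst z - fst y), frac (snd z - snd y))"
proof -
  have *: "min \<bar>a - b\<bar> (1 - \<bar>a - b\<bar>) = min \<bar>frac (b - a)\<bar> (1 - \<bar>frac (b - a)\<bar>)"
    if "0 \<le> a" "a < 1" "0 \<le> b" "b < 1" for a b :: real
  proof (cases "a \<le> b")
    case True
    then have "frac (b - a) = b - a" using that by (subst frac_eq) auto
    then show ?thesis by simp
  next
    case False
    then have "frac (b - a) = b - a + 1" using that by (subst frac_unique_iff) auto
    then show ?thesis using that False by (simp add: min_def)
  qed
  have "0 \<le> fst y" "fst y < 1" "0 \<le> snd y" "snd y < 1" "0 \<le> fst z" "fst z < 1" "0 \<le> snd z" "snd z < 1"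
    using assms by auto
  then show ?thesis
    unfolding torus_dist_def Let_def by (simp only: * fst_conv snd_conv diff_0 abs_minus_cancel)
qed

text \<open>Moving \<open>y\<close> to the origin preserves both the distance and the uniform
  measure. This is why the link probability does not depend on where one end lies.\<close>

lemma measure_torus_dist_homogeneous:
  assumes D: "D \<in> sets borel" and y: "y \<in> unit_square"
  shows "measure torus_unif {z. torus_dist y z \<in> D} = measure torus_unif {z. torus_dist (0, 0) z \<in> D}"
proof -
  have meas: "{z. torus_dist w z \<in> D} \<in> sets borel" for w
  proof -
    have "(\<lambda>z. torus_dist w z) \<in> borel_measurable borel" by measurable
    from measurable_sets[OF this D] show ?thesis by (simp add: vimage_def)
  qed
  have "emeasure torus_unif {z. torus_dist y z \<in> D} =
      (\<integral>\<^sup>+z. indicator {z. torus_dist (0, 0) z \<in> D} (frac (fst z - fst y), frac (snd z - snd y)) * indicator unit_square z \<partial>lborel)"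
    unfolding emeasure_torus_unif[OF meas]
  proof (rule nn_integral_cong)
    fix z
    show "indicator {z. torus_dist y z \<in> D} z * indicator unit_square z = (indicator {z. torus_dist (0, 0) z \<in> D}
        (frac (fst z - fst y), frac (snd z - snd y)) * indicator unit_square z :: ennreal)"
      using torus_dist_shift[OF y, of z] by (cases "z \<in> unit_square") (simp_all add: indicator_def)
  qed
  also have "\<dots> = (\<integral>\<^sup>+z. indicator {z. torus_dist (0, 0) z \<in> D} z * indicator unit_square z \<partial>lborel)"
    using y meas by (intro nn_integral_torus_shift) auto
  also have "\<dots> = emeasure torus_unif {z. torus_dist (0, 0) z \<in> D}"
    by (rule emeasure_torus_unif[OF meas, symmetric])
  finally show ?thesis by (simp add: measure_def)
qed

lemma torus_dist_le:
  assumes "x \<in> unit_square" "y \<in> unit_square"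
  shows "torus_dist x y \<le> \<bar>fst x - fst y\<bar> + \<bar>snd x - snd y\<bar>"
proof -
  let ?a = "\<bar>fst x - fst y\<bar>" and ?b = "\<bar>snd x - snd y\<bar>"
  have "torus_dist x y \<le> \<bar>min ?a (1 - ?a)\<bar> + \<bar>min ?b (1 - ?b)\<bar>"
    unfolding torus_dist_def Let_def by (rule sqrt_sum_squares_le_sum_abs)
  also have "\<dots> \<le> ?a + ?b"
    using assms by (intro add_mono) auto
  finally show ?thesis .
qed

text \<open>A crude diameter bound, enough to keep a decreasing \<open>L\<close> above the value
  \<open>L 2\<close> on the whole torus.\<close>

lemma torus_dist_le_2: "x \<in> unit_square \<Longrightarrow> y \<in> unit_square \<Longrightarrow> torus_dist x y \<le> 2"
  by (rule order_trans[OF torus_dist_le]) auto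

lemma torus_dist_eq_0:
  assumes "z \<in> unit_square" "torus_dist (0, 0) z = 0"
  shows "z = (0, 0)"
  using assms by (auto simp: torus_dist_def Let_def sum_power2_eq_zero_iff min_def split: if_splits)

section \<open>A grid of square cells on the torus\<close>

definition grid_cell :: "nat \<Rightarrow> real \<times> real \<Rightarrow> nat \<times> nat" where
  "grid_cell k z = (nat \<lfloor>real k * fst z\<rfloor>, nat \<lfloor>real k * snd z\<rfloor>)"

text \<open>Nonnegativity of \<open>x\<close> matters because \<open>nat\<close> sends every
  negative floor to 0, which would enlarge cell 0.\<close>

lemma nat_floor_eq_iff_interval:
  assumes "0 < k" "0 \<le> (x::real)"
  shows "nat \<lfloor>real k * x\<rfloor> = i \<longleftrightarrow> x \<in> {real i / real k..<real (Suc i) / real k}"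
proof -
  have "nat \<lfloor>real k * x\<rfloor> = i \<longleftrightarrow> \<lfloor>real k * x\<rfloor> = int i"
    using assms by (auto simp: nat_eq_iff)
  also have "\<dots> \<longleftrightarrow> real i \<le> real k * x \<and> real k * x < real i + 1"
    by (simp add: floor_eq_iff)
  finally show ?thesis using assms by (auto simp: field_simps)
qed

lemma grid_cell_less:
  assumes "z \<in> unit_square" "0 < k"
  shows "grid_cell k z \<in> {..<k} \<times> {..<k}"
proof -
  have "nat \<lfloor>real k * x\<rfloor> < k" if "0 \<le> x" "x < 1" for x :: real
    using that assms(2) by (simp add: nat_less_iff floor_less_iff)
  then show ?thesis using assms by (auto simp: grid_cell_def)
qed

lemma grid_cell_measurable: "Measurable.pred borel (\<lambda>z. grid_cell k z = q)"
proof -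
  have [measurable]: "(\<lambda>z. z) \<in> measurable borel (borel \<Otimes>\<^sub>M borel :: (real \<times> real) measure)"
    by (simp add: borel_prod)
  have "Measurable.pred borel (\<lambda>z::real\<times>real. nat \<lfloor>real k * fst z\<rfloor> = fst q \<and> nat \<lfloor>real k * snd z\<rfloor> = snd q)"
    by measurable
  then show ?thesis by (simp add: grid_cell_def prod_eq_iff)
qed

lemma measure_grid_cell:
  assumes "0 < k" "q \<in> {..<k} \<times> {..<k}"
  shows "measure torus_unif {z. grid_cell k z = q} = 1 / (real k)\<^sup>2"
proof -
  obtain i j where q: "q = (i, j)" "i < k" "j < k" using assms by auto
  let ?I = "\<lambda>i. {real i / real k..<real (Suc i) / real k}"
  have I: "0 \<le> x \<and> x < 1" if "x \<in> ?I i" "i < k" for x i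
  proof -
    have "real (Suc i) / real k \<le> 1" using that assms by (simp add: field_simps)
    moreover have "0 \<le> real i / real k" by simp
    moreover have "real i / real k \<le> x" "x < real (Suc i) / real k" using that by auto
    ultimately show ?thesis by linarith
  qed
  have sets: "{z. grid_cell k z = q} \<in> sets borel"
    using grid_cell_measurable[of k q] by (simp add: pred_def)
  have "emeasure torus_unif {z. grid_cell k z = q} = emeasure lborel (unit_square \<inter> {z. grid_cell k z = q})"
    using sets by (simp add: divide_ennreal_def)
  also have "unit_square \<inter> {z. grid_cell k z = q} = ?I i \<times> ?I j"
  proof (intro set_eqI)
    fix z
    show "z \<in> unit_square \<inter> {z. grid_cell k z = q} \<longleftrightarrow> z \<in> ?I i \<times> ?I j"
    proof (cases "z \<in> unit_square")
      case True
      then show ?thesis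
        using nat_floor_eq_iff_interval[OF assms(1), of "fst z" i] nat_floor_eq_iff_interval[OF assms(1), of "snd z" j]
        by (auto simp: grid_cell_def q(1) mem_Times_iff)
    next
      case False
      then show ?thesis
        using I[of "fst z" i] I[of "snd z" j] q by (auto simp: mem_Times_iff)
    qed
  qed
  also have "emeasure lborel \<dots> = ennreal (1 / (real k)\<^sup>2)"
    by (subst emeasure_lborel_Times)
      (use assms in \<open>auto simp: diff_divide_distrib[symmetric] ennreal_mult[symmetric] power2_eq_square divide_right_mono\<close>)
  finally show ?thesis by (simp add: measure_def)
qed

text \<open>Floors that differ by at most 1 put the coordinates within \<open>2 / k\<close> of each
  other; the two coordinates contribute \<open>2 / k\<close> each.\<close>

lemma torus_dist_near_cells:
  assumes "0 < k" "x \<in> unit_square" "y \<in> unit_square"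
    and "\<bar>int (fst (grid_cell k x)) - int (fst (grid_cell k y))\<bar> \<le> 1"
    and "\<bar>int (snd (grid_cell k x)) - int (snd (grid_cell k y))\<bar> \<le> 1"
  shows "torus_dist x y \<le> 4 / real k"
proof -
  have *: "\<bar>a - b\<bar> \<le> 2 / real k"
    if "0 \<le> a" "0 \<le> b" "\<bar>int (nat \<lfloor>real k * a\<rfloor>) - int (nat \<lfloor>real k * b\<rfloor>)\<bar> \<le> 1" for a b :: real
  proof -
    have "\<bar>\<lfloor>real k * a\<rfloor> - \<lfloor>real k * b\<rfloor>\<bar> \<le> 1" using that by simp
    then have "\<bar>real k * a - real k * b\<bar> \<le> 2" by linarith
    then show ?thesis using assms(1) by (simp add: field_simps abs_le_iff)
  qed
  have "torus_dist x y \<le> 2 / real k + 2 / real k"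
    using assms by (intro order_trans[OF torus_dist_le] add_mono *) (auto simp: grid_cell_def)
  then show ?thesis by simp
qed

section \<open>Minimum cuts of graphs with dense cells\<close>

text \<open>Two \<open>near\<close> cells span a complete bipartite graph, so a cut crossing fewer than \<open>m\<close> edges leaves in
  every cell fewer than \<open>a\<close> vertices on one side, and this minority side is the same for all cells.
  Then every vertex of the minority side has an edge across the cut, which compensates for
  the edge to its terminal that the cut may fail to count.\<close>
lemma cut_size_ge_min_degree:
  fixes adj :: "'a \<Rightarrow> 'a \<Rightarrow> bool" and cell :: "'a \<Rightarrow> 'q" and a w m :: nat
  assumes "finite U" "V \<subseteq> U"
    and cells: "\<And>u. u \<in> U \<Longrightarrow> cell u \<in> Q"
    and size: "\<And>q. q \<in> Q \<Longrightarrow> w \<le> card {u \<in> U. cell u = q}"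
    and w: "2 * a \<le> w" "0 < a" "2 * m \<le> a * w"
    and near: "\<And>u v. u \<in> U \<Longrightarrow> v \<in> U \<Longrightarrow> near (cell u) (cell v) \<Longrightarrow> adj u v"
    and refl: "\<And>q. near q q"
    and conn: "\<And>P q. q \<in> Q \<Longrightarrow> P q \<Longrightarrow> (\<And>q q'. q \<in> Q \<Longrightarrow> q' \<in> Q \<Longrightarrow> near q q' \<Longrightarrow> P q \<Longrightarrow> P q') \<Longrightarrow> \<forall>q'\<in>Q. P q'"
  shows "min (min (card {u \<in> U. adj s u}) (card {u \<in> U. adj u t})) m
    \<le> card {u \<in> U - V. adj s u} + card {(v, u) \<in> V \<times> (U - V). adj v u} + card {v \<in> V. adj v t}"
proof -
  \<comment> \<open>\<open>E\<close> collects the edges crossing the cut; \<open>F q\<close> and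
    \<open>G q\<close> are the two sides of the cut inside cell \<open>q\<close>.\<close>
  define E where "E = {(v, u) \<in> V \<times> (U - V). adj v u}"
  define F where "F q = {v \<in> V. cell v = q}" for q
  define G where "G q = {u \<in> U - V. cell u = q}" for q
  have fin: "finite V" "finite (U - V)"
    using assms(1,2) finite_subset[of V U] by auto
  have finE: "finite E"
    by (rule finite_subset[of _ "V \<times> (U - V)"]) (use fin in \<open>auto simp: E_def\<close>)
  have FG: "w \<le> card (F q) + card (G q)" if "q \<in> Q" for q
  proof -
    have "{u \<in> U. cell u = q} = F q \<union> G q" using assms(2) by (auto simp: F_def G_def)
    then show ?thesis using size[OF that] card_Un_le[of "F q" "G q"] by simp
  qed
  have edges: "card (F q) * card (G q') \<le> card E" if "near q q'" for q q'
  proof -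
    have "F q \<times> G q' \<subseteq> E" using near that assms(2) by (auto simp: E_def F_def G_def)
    then have "card (F q \<times> G q') \<le> card E" by (rule card_mono[OF finE])
    then show ?thesis by (simp add: card_cartesian_product)
  qed
  show ?thesis
  proof (cases "m \<le> card E")
    case True
    then show ?thesis unfolding E_def by linarith
  next
    case False
    \<comment> \<open>At least \<open>a\<close> vertices on one side and at least
      \<open>w / 2\<close> on the other give \<open>a * w / 2 \<ge> m\<close> crossing edges,
      contrary to the case assumption.\<close>
    have small: "False" if "near q q'" "a \<le> card (F q)" "a \<le> card (G q')" "w \<le> 2 * card (F q) \<or> w \<le> 2 * card (G q')" for q q'
    proof -
      have "a * w \<le> 2 * (card (F q) * card (G q'))"
        using that(4)
      proof
        assume "w \<le> 2 * card (F q)"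
        from mult_mono[OF this that(3)] show ?thesis by (simp add: ac_simps)
      next
        assume "w \<le> 2 * card (G q')"
        from mult_mono[OF that(2) this] show ?thesis by (simp add: ac_simps)
      qed
      then show False using edges[OF that(1)] w(3) False by linarith
    qed
    have G_small: "card (G q) < a" if "q \<in> Q" "a \<le> card (F q)" for q
    proof (rule ccontr)
      assume "\<not> card (G q) < a"
      then have "a \<le> card (G q)" by simp
      moreover have "w \<le> 2 * card (F q) \<or> w \<le> 2 * card (G q)" using FG[OF that(1)] by linarith
      ultimately show False using small[OF refl[of q] that(2)] by blast
    qed
    \<comment> \<open>In cell \<open>q\<close> the \<open>V\<close> side holds at least half of
      \<open>w\<close>, so \<open>G q'\<close> must stay below \<open>a\<close>. As
      \<open>w \<ge> 2 * a\<close>, this leaves at least \<open>a\<close> vertices for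
      \<open>F q'\<close>.\<close>
    have step: "a \<le> card (F q')" if "q \<in> Q" "q' \<in> Q" "near q q'" "a \<le> card (F q)" for q q'
    proof -
      have "w \<le> 2 * card (F q)" using G_small[OF that(1,4)] FG[OF that(1)] w(1) by linarith
      then have "card (G q') < a" using small[OF that(3,4)] by (meson not_le)
      then show ?thesis using FG[OF that(2)] w(1) by linarith
    qed
    show ?thesis
    proof (cases "\<exists>q\<in>Q. a \<le> card (F q)")
      case True
      then have all: "\<forall>q\<in>Q. a \<le> card (F q)"
        using conn[where P = "\<lambda>q. a \<le> card (F q)"] step by blast
      \<comment> \<open>Here \<open>V\<close> is strong in every cell, so each vertex outside
        \<open>V\<close> has a crossing edge from its own cell. These edges pay for the neighbours
        of \<open>t\<close> that lie outside \<open>V\<close>.\<close>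
      have "U - V \<subseteq> snd ` E"
      proof
        fix u assume u: "u \<in> U - V"
        then have "0 < card (F (cell u))" using all cells[of u] w(2) by fastforce
        then obtain v where "v \<in> V" "cell v = cell u" by (auto simp: F_def card_gt_0_iff)
        then have "(v, u) \<in> E" using u near[of v u] refl[of "cell u"] assms(2) by (auto simp: E_def)
        then show "u \<in> snd ` E" by force
      qed
      then have "card (U - V) \<le> card E" using surj_card_le finE by blast
      moreover have "card {u \<in> U. adj u t} \<le> card ({v \<in> V. adj v t} \<union> (U - V))"
        using fin by (intro card_mono) auto
      ultimately show ?thesis
        using card_Un_le[of "{v \<in> V. adj v t}" "U - V"] unfolding E_def by linarith
    next
      case False
      \<comment> \<open>The mirror case: \<open>V\<close> is weak in every cell, and crossing edges
        pay for the neighbours of \<open>s\<close> that lie in \<open>V\<close>.\<close>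
      have "V \<subseteq> fst ` E"
      proof
        fix v assume v: "v \<in> V"
        then have "cell v \<in> Q" using cells assms(2) by blast
        then have "0 < card (G (cell v))" using False FG[of "cell v"] w by fastforce
        then obtain u where "u \<in> U - V" "cell u = cell v" by (auto simp: G_def card_gt_0_iff)
        then have "(v, u) \<in> E" using v near[of v u] refl[of "cell u"] assms(2) by (auto simp: E_def)
        then show "v \<in> fst ` E" by force
      qed
      then have "card V \<le> card E" using surj_card_le finE by blast
      moreover have "card {u \<in> U. adj s u} \<le> card ({u \<in> U - V. adj s u} \<union> V)"
        using fin by (intro card_mono) auto
      ultimately show ?thesis
        using card_Un_le[of "{u \<in> U - V. adj s u}" V] unfolding E_def by linarith
    qed
  qed
qed

section \<open>Connectivity of the grid, and cuts as edge counts\<close>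

text \<open>Adjacency by a king's move or equality, without wrap-around: the flat grid is already
  connected.\<close>

definition near_cells :: "nat \<times> nat \<Rightarrow> nat \<times> nat \<Rightarrow> bool" where
  "near_cells p q \<longleftrightarrow> \<bar>int (fst p) - int (fst q)\<bar> \<le> 1 \<and> \<bar>int (snd p) - int (snd q)\<bar> \<le> 1"

lemma nat_path_connected:
  fixes i i' k :: nat
  assumes "i < k" "i' < k" "P i"
    and step: "\<And>i i'. i < k \<Longrightarrow> i' < k \<Longrightarrow> \<bar>int i - int i'\<bar> \<le> 1 \<Longrightarrow> P i \<Longrightarrow> P i'"
  shows "P i'"
proof (cases "i \<le> i'")
  case True
  then show ?thesis using assms(2)
  proof (induction i' rule: dec_induct)
    case (step n)
    then show ?case using assms(4)[of n "Suc n"] by simp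
  qed (rule assms(3))
next
  case False
  then have "i' \<le> i" by simp
  then show ?thesis
  proof (induction i' rule: inc_induct)
    case (step n)
    then show ?case using assms(4)[of "Suc n" n] assms(1) by simp
  qed (rule assms(3))
qed

text \<open>A path first adjusts the row index and then the column index, one unit at a time. This
  discharges the propagation hypothesis \<open>conn\<close> of the cut lemma.\<close>

lemma grid_connected:
  assumes "q \<in> {..<k} \<times> {..<k}" "P q"
    and step: "\<And>q q'. q \<in> {..<k} \<times> {..<k} \<Longrightarrow> q' \<in> {..<k} \<times> {..<k} \<Longrightarrow> near_cells q q' \<Longrightarrow> P q \<Longrightarrow> P q'"
  shows "\<forall>q'\<in>{..<k} \<times> {..<k}. P q'"
proof
  fix q' assume q': "q' \<in> {..<k} \<times> {..<k}"
  have "P (fst q', snd q)"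
  proof (rule nat_path_connected[of "fst q" k "fst q'" "\<lambda>i. P (i, snd q)"])
    fix i i' assume "i < k" "i' < k" "\<bar>int i - int i'\<bar> \<le> 1" "P (i, snd q)"
    then show "P (i', snd q)"
      using assms(1) by - (rule step[of "(i, snd q)"], auto simp: near_cells_def)
  qed (use assms(1,2) q' in auto)
  then have "P (fst q', snd q')"
  proof (rule nat_path_connected[of "snd q" k "snd q'" "\<lambda>j. P (fst q', j)", rotated 2])
    fix i i' assume "i < k" "i' < k" "\<bar>int i - int i'\<bar> \<le> 1" "P (fst q', i)"
    then show "P (fst q', i')"
      using q' by - (rule step[of "(fst q', i)"], auto simp: near_cells_def)
  qed (use assms(1) q' in auto)
  then show "P q'" by simp
qed

text \<open>Since every link carries \<open>R\<close> or 0, bounding a cut capacity becomes counting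
  edges.\<close>

lemma cut_cap_uniform:
  assumes "finite U" "V \<subseteq> U"
  shows "cut_cap (\<lambda>i j. if adj i j then R else 0) s t U V =
    R * real (card {u \<in> U - V. adj s u} + card {(v, u) \<in> V \<times> (U - V). adj v u} + card {v \<in> V. adj v t})"
proof -
  have *: "(\<Sum>u\<in>S. if P u then R else 0) = R * real (card {u \<in> S. P u})" if "finite S" for S :: "'b set" and P
    using that by (simp add: sum.If_cases Int_def)
  have fin: "finite V" "finite (U - V)" using assms finite_subset[of V U] by auto
  have "(\<Sum>v\<in>V. \<Sum>u\<in>U - V. if adj v u then R else 0) = (\<Sum>p\<in>V \<times> (U - V). if adj (fst p) (snd p) then R else 0)"
    by (subst sum.cartesian_product) (simp add: case_prod_beta)
  also have "\<dots> = R * real (card {p \<in> V \<times> (U - V). adj (fst p) (snd p)})"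
    using fin by (intro *) auto
  also have "{p \<in> V \<times> (U - V). adj (fst p) (snd p)} = {(v, u) \<in> V \<times> (U - V). adj v u}"
    by auto
  finally show ?thesis
    using fin by (simp add: cut_cap_def * distrib_left)
qed

lemma net_cap_ge_iff:
  assumes "finite T" "T \<noteq> {}" "finite U"
  shows "c \<le> net_cap C s T U \<longleftrightarrow> (\<forall>t\<in>T. \<forall>V\<in>Pow U. c \<le> cut_cap C s t U V)"
proof -
  have "c \<le> st_cap C s t U \<longleftrightarrow> (\<forall>V\<in>Pow U. c \<le> cut_cap C s t U V)" for t
    unfolding st_cap_def using assms(3) by (subst Min_ge_iff) auto
  then show ?thesis
    unfolding net_cap_def using assms(1,2) by (subst Min_ge_iff) auto
qed

section \<open>Concentration of the network coding capacity\<close>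

text \<open>Exponential decay beats every power, so the failure probability of the cells can be
  absorbed into \<open>m powr (- \<theta>)\<close>.\<close>

lemma eventually_exp_le_powr:
  fixes c K \<theta> :: real
  assumes "0 < c" "0 < K"
  shows "eventually (\<lambda>m. K * exp (- (c * real m)) \<le> real m powr (- \<theta>)) sequentially"
proof -
  obtain N :: nat where N: "\<theta> \<le> real N" using real_arch_simple by blast
  have "filterlim (\<lambda>m. c * real m) at_top sequentially"
    using assms(1) by (intro filterlim_tendsto_pos_mult_at_top[OF tendsto_const] filterlim_real_sequentially)
  from filterlim_compose[OF tendsto_power_div_exp_0[of N] this]
  have "eventually (\<lambda>m. (c * real m) ^ N / exp (c * real m) < c ^ N / K) sequentially"
    by (rule order_tendstoD) (use assms in auto)
  then show ?thesis
    using eventually_ge_at_top[of 1]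
  proof eventually_elim
    case (elim m)
    have "real m powr \<theta> \<le> real m powr real N" using N elim(2) by (intro powr_mono) auto
    also have "\<dots> = real m ^ N" using elim(2) by (simp add: powr_realpow)
    also have "\<dots> \<le> exp (c * real m) / K"
      using elim(1) assms by (simp add: power_mult_distrib field_simps)
    finally show ?case
      using elim(2) assms by (simp add: powr_minus exp_minus field_simps)
  qed
qed

section \<open>Node positions: measurability, almost sure facts and expectations\<close>

lemma prob_space_node_space: "prob_space (node_space n)"
  unfolding node_space_def by (rule prob_space_PiM) (rule prob_space_torus_unif)

lemma measurable_node_space_component:
  "i < n \<Longrightarrow> (\<lambda>x. x i) \<in> measurable (node_space n) borel"
  unfolding node_space_def
  using measurable_component_singleton[of i "{..<n}" "\<lambda>_. torus_unif"] by (simp cong: measurable_cong_sets)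

lemma AE_node_space: "AE x in node_space n. \<forall>i<n. x i \<in> unit_square"
proof -
  have "AE x in node_space n. \<forall>i\<in>{..<n}. x i \<in> unit_square"
    unfolding node_space_def
    by (intro eventually_ball_finite ballI AE_PiM_component prob_space_torus_unif AE_torus_unif) auto
  then show ?thesis by eventually_elim auto
qed

text \<open>If the mean is 0, the threshold is 0 whatever value \<open>eps\<close> takes (its
  formula then divides by zero), and capacities are nonnegative, so the event is the whole
  space.\<close>

lemma prob_net_cap_ge_trivial:
  assumes nonneg: "\<And>x i j. 0 \<le> C x i j"
    and T: "finite T" "T \<noteq> {}" and U: "finite U" and "EC0 = 0" "0 \<le> \<delta>"
  shows "1 - \<delta> \<le> measure (node_space n) {x \<in> space (node_space n). (1 - eps) * EC0 \<le> net_cap (C x) s T U}"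
proof -
  interpret prob_space "node_space n" by (rule prob_space_node_space)
  have "0 \<le> net_cap (C x) s T U" for x
    using T U by (subst net_cap_ge_iff) (auto simp: cut_cap_def nonneg intro!: add_nonneg_nonneg sum_nonneg)
  then have "{x \<in> space (node_space n). (1 - eps) * EC0 \<le> net_cap (C x) s T U} = space (node_space n)"
    using \<open>EC0 = 0\<close> by auto
  then show ?thesis using \<open>0 \<le> \<delta>\<close> by (simp add: prob_space)
qed

lemma pred_pair_torus_dist:
  assumes "D \<in> sets borel"
  shows "Measurable.pred (torus_unif \<Otimes>\<^sub>M torus_unif) (\<lambda>(y, z). torus_dist y z \<in> D)"
proof -
  have "fst \<in> measurable (torus_unif \<Otimes>\<^sub>M torus_unif) torus_unif" "snd \<in> measurable (torus_unif \<Otimes>\<^sub>M torus_unif) torus_unif"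
    by simp_all
  then have "(\<lambda>q. torus_dist (fst q) (snd q)) \<in> borel_measurable (torus_unif \<Otimes>\<^sub>M torus_unif)"
    by (intro torus_dist_measurable) (simp_all cong: measurable_cong_sets)
  from measurable_sets[OF this assms] show ?thesis
    by (simp add: pred_def vimage_def case_prod_beta Int_def conj_commute)
qed

lemma AE_measure_torus_dist:
  assumes "D \<in> sets borel"
  shows "AE y in torus_unif. measure torus_unif {z \<in> space torus_unif. torus_dist y z \<in> D}
    = measure torus_unif {z. torus_dist (0, 0) z \<in> D}"
  using AE_torus_unif
proof eventually_elim
  case (elim y)
  from measure_torus_dist_homogeneous[OF assms this] show ?case by simp
qed

lemma pred_node_dist:
  assumes "D \<in> sets borel" "i < n" "j < n"
  shows "Measurable.pred (node_space n) (\<lambda>x. torus_dist (x i) (x j) \<in> D)"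
proof -
  have "(\<lambda>x. torus_dist (x i) (x j)) \<in> borel_measurable (node_space n)"
    using assms by (intro torus_dist_measurable measurable_node_space_component)
  from measurable_sets[OF this assms(1)] show ?thesis
    by (simp add: pred_def vimage_def Int_def conj_commute)
qed

lemma expected_star_capacity:
  assumes D: "D \<in> sets borel" and "s < n" "U \<subseteq> {..<n}" "s \<notin> U"
  shows "(\<integral>x. (\<Sum>u\<in>U. if torus_dist (x s) (x u) \<in> D then R else 0) \<partial>node_space n)
    = R * (real (card U) * measure torus_unif {z. torus_dist (0, 0) z \<in> D})"
proof -
  interpret prob_space "node_space n" by (rule prob_space_node_space)
  let ?p = "measure torus_unif {z. torus_dist (0, 0) z \<in> D}"
  define B where "B u = {x \<in> space (node_space n). torus_dist (x s) (x u) \<in> D}" for u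
  have B: "B u \<in> sets (node_space n)" if "u \<in> U" for u
    using pred_node_dist[OF D, of s n u] that assms by (auto simp: B_def pred_def)
  have "(\<integral>x. (\<Sum>u\<in>U. if torus_dist (x s) (x u) \<in> D then R else 0) \<partial>node_space n)
      = (\<integral>x. (\<Sum>u\<in>U. R * indicator (B u) x) \<partial>node_space n)"
    by (intro Bochner_Integration.integral_cong sum.cong) (auto simp: B_def)
  also have "\<dots> = (\<Sum>u\<in>U. \<integral>x. R * indicator (B u) x \<partial>node_space n)"
    using B by (intro Bochner_Integration.integral_sum) (auto simp: emeasure_eq_measure)
  also have "\<dots> = (\<Sum>u\<in>U. R * ?p)"
  proof (rule sum.cong[OF refl])
    fix u assume u: "u \<in> U"
    have "prob (B u) = ?p"
      using u assms unfolding B_def node_space_def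
      by (intro prob_PiM_pair prob_space_torus_unif pred_pair_torus_dist AE_measure_torus_dist) auto
    then show "(\<integral>x. R * indicator (B u) x \<partial>node_space n) = R * ?p"
      using B[OF u] by simp
  qed
  finally show ?thesis by simp
qed

lemma pred_card_le:
  fixes c :: real
  assumes "finite U" "\<And>u. u \<in> U \<Longrightarrow> Measurable.pred M (Q u)"
  shows "{x \<in> space M. real (card {u \<in> U. Q u x}) \<le> c} \<in> sets M"
proof -
  have "real (card {u \<in> U. Q u x}) = (\<Sum>u\<in>U. if Q u x then 1 else 0)" for x
    using assms(1) by (simp add: sum.If_cases Int_def)
  moreover have "(\<lambda>x. \<Sum>u\<in>U. if Q u x then 1 else 0 :: real) \<in> borel_measurable M"
    using assms(2) by (intro borel_measurable_sum measurable_If) auto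
  ultimately show ?thesis by simp
qed

text \<open>Unfolding the minima leaves finitely many conditions, one for each destination and
  cut.\<close>

lemma net_cap_event_measurable:
  assumes "finite T" "T \<noteq> {}" "finite U"
    and C: "\<And>i j. i \<in> insert s U \<Longrightarrow> j \<in> U \<union> T \<Longrightarrow> (\<lambda>x. C x i j) \<in> borel_measurable M"
  shows "{x \<in> space M. c \<le> net_cap (C x) s T U} \<in> sets M"
proof -
  have "{x \<in> space M. c \<le> net_cap (C x) s T U} = {x \<in> space M. \<forall>t\<in>T. \<forall>V\<in>Pow U. c \<le> cut_cap (C x) s t U V}"
    using assms by (simp add: net_cap_ge_iff)
  also have "\<dots> \<in> sets M"
  proof (intro sets.sets_Collect_finite_All')
    fix t V assume "t \<in> T" "V \<in> Pow U"
    then have "(\<lambda>x. cut_cap (C x) s t U V) \<in> borel_measurable M"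
      unfolding cut_cap_def by (intro borel_measurable_add borel_measurable_sum C) auto
    then show "{x \<in> space M. c \<le> cut_cap (C x) s t U V} \<in> sets M" by measurable
  qed (use assms in auto)
  finally show ?thesis .
qed

text \<open>For a radius \<open>r\<close> within which all links are present, cells of side \<open>1 / k\<close> with \<open>4 / k \<le> r\<close>
  are near enough that neighbouring cells are completely joined.\<close>
lemma net_cap_ge_of_degrees:
  fixes x :: "nat \<Rightarrow> real \<times> real"
  assumes U: "finite U" and V: "V \<subseteq> U"
    and D: "{0..r} \<subseteq> D" and k: "0 < k" "4 / real k \<le> r" and m: "32 * k ^ 4 \<le> card U"
    and sq: "\<And>u. u \<in> U \<Longrightarrow> x u \<in> unit_square"
    and s: "c \<le> real (card {u \<in> U. torus_dist (x s) (x u) \<in> D})"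
    and t: "c \<le> real (card {u \<in> U. torus_dist (x t) (x u) \<in> D})"
    and c: "c \<le> real (card U)" and R: "0 \<le> R"
    and cell: "\<And>q. q \<in> {..<k} \<times> {..<k} \<Longrightarrow> real (card U) / (2 * (real k)\<^sup>2) \<le> real (card {u \<in> U. grid_cell k (x u) = q})"
  shows "R * c \<le> cut_cap (\<lambda>i j. if torus_dist (x i) (x j) \<in> D then R else 0) s t U V"
proof -
  let ?adj = "\<lambda>i j. torus_dist (x i) (x j) \<in> D"
  \<comment> \<open>Half the mean number of relays per cell, rounded down. With
    \<open>a = 8 * k\<^sup>2\<close> below, the bound \<open>32 * k ^ 4\<close> on
    \<open>card U\<close> is what \<open>2 * a \<le> w\<close> requires.\<close>
  define w where "w = card U div (2 * k\<^sup>2)"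
  have "min (min (card {u \<in> U. ?adj s u}) (card {u \<in> U. ?adj u t})) (card U)
    \<le> card {u \<in> U - V. ?adj s u} + card {(v, u) \<in> V \<times> (U - V). ?adj v u} + card {v \<in> V. ?adj v t}"
  proof (rule cut_size_ge_min_degree[where cell = "\<lambda>u. grid_cell k (x u)" and Q = "{..<k} \<times> {..<k}"
        and w = w and a = "8 * k\<^sup>2" and near = near_cells])
    show "grid_cell k (x u) \<in> {..<k} \<times> {..<k}" if "u \<in> U" for u
      using grid_cell_less[OF sq[OF that] k(1)] .
    show "w \<le> card {u \<in> U. grid_cell k (x u) = q}" if "q \<in> {..<k} \<times> {..<k}" for q
    proof -
      have "real w \<le> real (card U) / real (2 * k\<^sup>2)"
        unfolding w_def by (rule of_nat_div_le_of_nat)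
      also have "\<dots> \<le> real (card {u \<in> U. grid_cell k (x u) = q})"
        using cell[OF that] by simp
      finally show ?thesis by simp
    qed
    have "16 * k\<^sup>2 * (2 * k\<^sup>2) \<le> card U" using m by simp
    then show "2 * (8 * k\<^sup>2) \<le> w"
      unfolding w_def using k by (subst less_eq_div_iff_mult_less_eq) auto
    show "0 < 8 * k\<^sup>2" using k by simp
    \<comment> \<open>The rounding loss is below \<open>2 * k\<^sup>2\<close>, at most a sixteenth
      of \<open>card U\<close>, so \<open>2 * k\<^sup>2 * w\<close> exceeds half of
      \<open>card U\<close>.\<close>
    have "card U = 2 * k\<^sup>2 * w + card U mod (2 * k\<^sup>2)"
      unfolding w_def by (rule mult_div_mod_eq[symmetric])
    moreover have "card U mod (2 * k\<^sup>2) < 2 * k\<^sup>2" using k by (intro mod_less_divisor) auto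
    moreover have "k\<^sup>2 \<le> k ^ 4" using k by (intro power_increasing) auto
    ultimately show "2 * card U \<le> 8 * k\<^sup>2 * w" using m by linarith
    show "?adj u v" if "u \<in> U" "v \<in> U" "near_cells (grid_cell k (x u)) (grid_cell k (x v))" for u v
    proof -
      have "torus_dist (x u) (x v) \<le> 4 / real k"
        using that k sq by (intro torus_dist_near_cells) (auto simp: near_cells_def)
      then show ?thesis using D k(2) torus_dist_nonneg[of "x u" "x v"] by auto
    qed
    show "near_cells q q" for q by (simp add: near_cells_def)
    show "\<forall>q'\<in>{..<k} \<times> {..<k}. P q'"
      if "q \<in> {..<k} \<times> {..<k}" "P q"
        "\<And>q q'. q \<in> {..<k} \<times> {..<k} \<Longrightarrow> q' \<in> {..<k} \<times> {..<k} \<Longrightarrow> near_cells q q' \<Longrightarrow> P q \<Longrightarrow> P q'" for P q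
      using that by (rule grid_connected)
  qed (fact U V)+
  moreover have "c \<le> real (card {u \<in> U. ?adj u t})"
    using t by (simp add: torus_dist_commute)
  ultimately have "c \<le> real (card {u \<in> U - V. ?adj s u} + card {(v, u) \<in> V \<times> (U - V). ?adj v u} + card {v \<in> V. ?adj v t})"
    using s c unfolding min_le_iff_disj by (elim disjE) linarith+
  then show ?thesis
    unfolding cut_cap_uniform[OF U V] using R by (rule mult_left_mono)
qed

text \<open>A union bound over three kinds of failure: low degree of \<open>s\<close>, low degree of
  a destination, and a sparse cell. The threshold \<open>M\<close> depends on neither
  \<open>n\<close> nor the chosen nodes.\<close>

lemma net_cap_concentration:
  fixes R \<theta> :: real
  assumes D: "D \<in> sets borel" and r: "0 < r" "{0..r} \<subseteq> D" and R: "0 < R" "R \<le> 1" and \<theta>: "0 < \<theta>"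
    and p: "p = measure torus_unif {z. torus_dist (0, 0) z \<in> D}" "0 < p"
  shows "\<exists>M::nat. \<forall>n::nat. \<forall>m\<ge>M. \<forall>s T U. s < n \<and> T \<subseteq> {..<n} \<and> U \<subseteq> {..<n} \<and> s \<notin> U \<and> T \<inter> U = {}
    \<and> T \<noteq> {} \<and> card U = m \<longrightarrow>
    1 - 3 * real (card T) / real m powr \<theta> \<le> measure (node_space n) {x \<in> space (node_space n).
      (1 - sqrt (2 * \<theta> * ln (real m) / (R * (real m * p)))) * (R * (real m * p))
        \<le> net_cap (\<lambda>i j. if torus_dist (x i) (x j) \<in> D then R else 0) s T U}"
proof -
  obtain k :: nat where k: "0 < k" "4 / real k \<le> r"
  proof -
    obtain k :: nat where k: "4 / r < real k" using reals_Archimedean2 by blast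
    with r have "0 < real k" by (smt (verit) divide_pos_pos)
    then show ?thesis using that[of k] k r by (simp add: field_simps)
  qed
  \<comment> \<open>There are \<open>k\<^sup>2\<close> cells of mean occupancy
    \<open>m / k\<^sup>2\<close>; the Chernoff bound with \<open>\<delta> = 1 / 2\<close> gives the
    rate \<open>1 / (8 * k\<^sup>2)\<close>.\<close>
  have "eventually (\<lambda>m. (real k)\<^sup>2 * exp (- (1 / (8 * (real k)\<^sup>2) * real m)) \<le> real m powr (- \<theta>)) sequentially"
    using k by (intro eventually_exp_le_powr) auto
  then obtain M0 where M0: "(real k)\<^sup>2 * exp (- (1 / (8 * (real k)\<^sup>2) * real m)) \<le> real m powr (- \<theta>)" if "M0 \<le> m" for m
    by (auto simp: eventually_sequentially)
  interpret torus: prob_space torus_unif by (rule prob_space_torus_unif)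
  have p1: "p \<le> 1" unfolding p(1) by (rule torus.prob_le_1)
  show ?thesis
  proof (intro exI[of _ "max M0 (32 * k ^ 4)"] allI impI)
    fix n m s :: nat and T U :: "nat set"
    assume m: "max M0 (32 * k ^ 4) \<le> m"
      and asm: "s < n \<and> T \<subseteq> {..<n} \<and> U \<subseteq> {..<n} \<and> s \<notin> U \<and> T \<inter> U = {} \<and> T \<noteq> {} \<and> card U = m"
    interpret prob_space "node_space n" by (rule prob_space_node_space)
    have fin: "finite T" "finite U" using asm finite_subset[OF _ finite_lessThan] by auto
    have m1: "1 \<le> m" using m k(1) by (metis One_nat_def Suc_leI le_trans max.cobounded2 mult_pos_pos zero_less_numeral zero_less_power)
    define \<mu> where "\<mu> = real m * p"
    define eps where "eps = sqrt (2 * \<theta> * ln (real m) / (R * \<mu>))"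
    let ?adj = "\<lambda>x i j. torus_dist (x i) (x j) \<in> D"
    let ?P = "node_space n"
    have \<mu>: "0 < \<mu>" using m1 p by (simp add: \<mu>_def)
    have ln: "0 \<le> ln (real m)" using m1 by simp
    have eps: "0 \<le> eps" using R \<theta> \<mu> ln by (simp add: eps_def)
    \<comment> \<open>The choice of \<open>eps\<close> turns the Chernoff exponent into
      \<open>\<theta> * ln m / R\<close>, which is at least \<open>\<theta> * ln m\<close> because
      \<open>R \<le> 1\<close>.\<close>
    have exponent: "exp (- (\<mu> * eps\<^sup>2 / 2)) \<le> real m powr (- \<theta>)"
    proof -
      have "eps\<^sup>2 = 2 * \<theta> * ln (real m) / (R * \<mu>)"
        unfolding eps_def using R \<theta> \<mu> ln by (intro real_sqrt_pow2) auto
      then have "\<mu> * eps\<^sup>2 / 2 = \<theta> * ln (real m) / R"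
        using \<mu> R by (simp add: field_simps)
      moreover have "\<theta> * ln (real m) \<le> \<theta> * ln (real m) / R"
        using R \<theta> ln by (simp add: le_divide_eq mult_left_le)
      ultimately show ?thesis using m1 by (simp add: powr_def)
    qed

    define G where "G v = {x \<in> space ?P. real (card {u \<in> U. ?adj x v u}) \<le> (1 - eps) * \<mu>}" for v
    define H where "H q = {x \<in> space ?P. real (card {u \<in> U. grid_cell k (x u) = q}) \<le> (1 - 1 / 2) * (real (card U) * (1 / (real k)\<^sup>2))}" for q
    let ?Q = "{..<k} \<times> {..<k}"
    have G_sets: "G v \<in> sets ?P" if "v < n" for v
      unfolding G_def using asm that fin by (intro pred_card_le pred_node_dist D) auto
    have H_sets: "H q \<in> sets ?P" for q
    proof -
      have "Measurable.pred ?P (\<lambda>x. grid_cell k (x u) = q)" if "u \<in> U" for u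
        using measurable_compose[OF measurable_node_space_component grid_cell_measurable, of u n k q] that asm by auto
      then show ?thesis unfolding H_def using fin by (intro pred_card_le)
    qed
    have G_prob: "prob (G v) \<le> real m powr (- \<theta>)" if "v < n" "v \<notin> U" for v
    proof -
      have "AE y in torus_unif. measure torus_unif {z \<in> space torus_unif. torus_dist y z \<in> D} = p"
        unfolding p(1) by (rule AE_measure_torus_dist[OF D])
      then have "prob (G v) \<le> exp (- (real (card U) * p * eps\<^sup>2 / 2))"
        using prob_star_degree_le[OF prob_space_torus_unif, of "{..<n}" v U "\<lambda>y z. torus_dist y z \<in> D" p eps]
          pred_pair_torus_dist[OF D] that asm eps p(2) p1
        unfolding G_def \<mu>_def node_space_def by simp
      then show ?thesis using exponent asm by (simp add: \<mu>_def)
    qed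
    have H_prob: "prob (H q) \<le> exp (- (1 / (8 * (real k)\<^sup>2) * real m))" if q: "q \<in> ?Q" for q
    proof -
      \<comment> \<open>Cell occupancy is treated as a degree: the relation ignores its first
        argument, so any centre outside \<open>U\<close> will do, and \<open>s\<close> is
        taken.\<close>
      have "Measurable.pred (torus_unif \<Otimes>\<^sub>M torus_unif) (\<lambda>(y, z). grid_cell k z = q)"
      proof -
        have "snd \<in> measurable (torus_unif \<Otimes>\<^sub>M torus_unif) torus_unif" by simp
        then have "snd \<in> measurable (torus_unif \<Otimes>\<^sub>M torus_unif) borel" by (simp cong: measurable_cong_sets)
        from measurable_compose[OF this grid_cell_measurable] show ?thesis by (simp add: case_prod_beta)
      qed
      moreover have "AE y in torus_unif. measure torus_unif {z \<in> space torus_unif. grid_cell k z = q} = 1 / (real k)\<^sup>2"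
        using measure_grid_cell[OF k(1) q] by simp
      ultimately have "prob (H q) \<le> exp (- (real (card U) * (1 / (real k)\<^sup>2) * (1 / 2)\<^sup>2 / 2))"
        unfolding H_def node_space_def using asm k
        by (intro prob_star_degree_le[where A = "\<lambda>y z. grid_cell k z = q" and s = s] prob_space_torus_unif) auto
      then show ?thesis using asm by (simp add: power2_eq_square field_simps)
    qed

    define good where "good = {x \<in> space ?P. (1 - eps) * (R * \<mu>) \<le> net_cap (\<lambda>i j. if ?adj x i j then R else 0) s T U}"
    have good_sets: "good \<in> sets ?P"
      unfolding good_def
    proof (rule net_cap_event_measurable)
      fix i j assume "i \<in> insert s U" "j \<in> U \<union> T"
      then have "i < n" "j < n" using asm by auto
      then show "(\<lambda>x. if ?adj x i j then R else 0) \<in> borel_measurable ?P"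
        by (intro measurable_If pred_node_dist[unfolded pred_def] D) auto
    qed (use fin asm in auto)
    define bad where "bad = G s \<union> (\<Union>t\<in>T. G t) \<union> (\<Union>q\<in>?Q. H q)"
    have bad_sets: "bad \<in> sets ?P"
      unfolding bad_def using asm fin G_sets H_sets by (intro sets.Un sets.finite_UN) auto
    \<comment> \<open>The inclusion holds only almost surely, since the cut bound needs all relays
      to lie in the unit square.\<close>
    have "AE x in ?P. x \<in> space ?P - good \<longrightarrow> x \<in> bad"
      using AE_node_space[of n]
    proof eventually_elim
      case (elim x)
      have "x \<in> good" if x: "x \<in> space ?P" "x \<notin> bad"
      proof -
        have sq: "x u \<in> unit_square" if "u \<in> U" for u using elim asm that by auto
        have deg: "(1 - eps) * \<mu> \<le> real (card {u \<in> U. ?adj x v u})" if "v = s \<or> v \<in> T" for v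
          using x that by (auto simp: bad_def G_def)
        have cells: "real (card U) / (2 * (real k)\<^sup>2) \<le> real (card {u \<in> U. grid_cell k (x u) = q})" if "q \<in> ?Q" for q
        proof -
          have "x \<notin> H q" using x(2) that by (auto simp: bad_def)
          then show ?thesis using x(1) by (simp add: H_def)
        qed
        have "(1 - eps) * \<mu> \<le> 1 * \<mu>" using eps \<mu> by (intro mult_right_mono) auto
        also have "\<dots> \<le> real (card U)" using asm p1 by (simp add: \<mu>_def mult_left_le)
        finally have c: "(1 - eps) * \<mu> \<le> real (card U)" .
        have "R * ((1 - eps) * \<mu>) \<le> cut_cap (\<lambda>i j. if ?adj x i j then R else 0) s t U V"
          if "t \<in> T" "V \<subseteq> U" for t V
          using that asm R m by (intro net_cap_ge_of_degrees[OF fin(2) _ r(2) k _ sq deg deg c _ cells]) auto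
        then show ?thesis
          unfolding good_def using x(1) fin asm by (simp add: net_cap_ge_iff ac_simps)
      qed
      then show ?case by blast
    qed
    then have "prob (space ?P - good) \<le> prob bad"
      by (rule finite_measure_mono_AE[OF _ bad_sets])
    also have "\<dots> \<le> prob (G s) + prob (\<Union>t\<in>T. G t) + prob (\<Union>q\<in>?Q. H q)"
    proof -
      have 1: "(\<Union>t\<in>T. G t) \<in> sets ?P" "(\<Union>q\<in>?Q. H q) \<in> sets ?P" "G s \<in> sets ?P"
        using asm fin G_sets H_sets by (auto intro!: sets.finite_UN)
      show ?thesis
        unfolding bad_def
        using measure_Un_le[OF sets.Un[OF 1(3) 1(1)] 1(2)] measure_Un_le[OF 1(3) 1(1)] by linarith
    qed
    also have "prob (\<Union>t\<in>T. G t) \<le> (\<Sum>t\<in>T. prob (G t))"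
      using asm fin G_sets by (intro measure_UNION_le) auto
    also have "\<dots> \<le> (\<Sum>t\<in>T. real m powr (- \<theta>))"
      using asm by (intro sum_mono G_prob) auto
    also have "prob (\<Union>q\<in>?Q. H q) \<le> (\<Sum>q\<in>?Q. prob (H q))"
      using H_sets by (intro measure_UNION_le) auto
    also have "\<dots> \<le> (\<Sum>q\<in>?Q. exp (- (1 / (8 * (real k)\<^sup>2) * real m)))"
      by (intro sum_mono H_prob)
    also have "\<dots> \<le> real m powr (- \<theta>)"
      using M0[of m] m by (simp add: card_cartesian_product power2_eq_square)
    also have "prob (G s) \<le> real m powr (- \<theta>)"
      using asm by (intro G_prob) auto
    finally have "prob (space ?P - good) \<le> (2 + real (card T)) * real m powr (- \<theta>)"
      by (simp add: algebra_simps)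
    \<comment> \<open>The terms of \<open>s\<close> and of the cells are charged to a destination,
      as \<open>T\<close> is nonempty; hence the constant 3.\<close>
    also have "\<dots> \<le> 3 * real (card T) * real m powr (- \<theta>)"
    proof -
      have "1 \<le> card T" using asm fin by (simp add: Suc_leI card_gt_0_iff)
      then show ?thesis by (intro mult_right_mono) auto
    qed
    finally have "1 - 3 * real (card T) / real m powr \<theta> \<le> prob good"
      using prob_compl[OF good_sets] by (simp add: powr_minus divide_inverse)
    then show "1 - 3 * real (card T) / real m powr \<theta> \<le> prob {x \<in> space ?P.
      (1 - sqrt (2 * \<theta> * ln (real m) / (R * (real m * p)))) * (R * (real m * p))
        \<le> net_cap (\<lambda>i j. if ?adj x i j then R else 0) s T U}"
      by (simp add: good_def eps_def \<mu>_def)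
  qed
qed

section \<open>Links without interference and with it\<close>

text \<open>If \<open>D\<close> had no positive element, only the origin itself could be linked to
  the origin, a null set.\<close>

lemma link_prob_pos_imp_radius:
  assumes D: "D \<in> sets borel" and pos: "0 < measure torus_unif {z. torus_dist (0, 0) z \<in> D}"
  shows "\<exists>d\<in>D. 0 < d"
proof (rule ccontr)
  assume neg: "\<not> ?thesis"
  let ?B = "{z. torus_dist (0, 0) z \<in> D}"
  have "unit_square \<inter> ?B \<subseteq> {(0, 0)}"
  proof
    fix z assume z: "z \<in> unit_square \<inter> ?B"
    then have "\<not> 0 < torus_dist (0, 0) z" using neg by blast
    then have "torus_dist (0, 0) z = 0" using torus_dist_nonneg[of "(0, 0)" z] by linarith
    then show "z \<in> {(0, 0)}" using torus_dist_eq_0[of z] z by blast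
  qed
  then have "finite (unit_square \<inter> ?B)" by (rule finite_subset) simp
  then have 0: "emeasure lborel (unit_square \<inter> ?B) = 0"
    using finite_imp_null_set_lborel by blast
  have "(\<lambda>z. torus_dist (0, 0) z) \<in> borel_measurable borel" by measurable
  from measurable_sets[OF this D] have "?B \<in> sets borel" by (simp add: vimage_def)
  then have "emeasure torus_unif ?B = 0" by (subst emeasure_uniform_measure) (use 0 in auto)
  then show False using pos by (simp add: measure_def)
qed

text \<open>Each interferer contributes at least \<open>L 2 > 0\<close>. The bound on
  \<open>n\<close> makes \<open>\<beta>\<close> times the interference term exceed 1, while the
  signal is at most 1.\<close>

lemma AE_link_cap_eq_0:
  assumes L: "\<And>x y. 0 \<le> x \<Longrightarrow> x < y \<Longrightarrow> L y < L x" "\<And>x. 0 \<le> x \<Longrightarrow> 0 \<le> L x \<and> L x \<le> 1"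
    and pos: "0 < \<beta>" "0 < \<gamma>" "0 \<le> N0 / P0"
    and n: "1 / (\<beta> * \<gamma> * L 2) + 2 < real n"
  shows "AE x in node_space n. \<forall>i<n. \<forall>j<n. link_cap L N0 P0 \<gamma> \<beta> R n x i j = 0"
  using AE_node_space[of n]
proof eventually_elim
  case (elim x)
  have L2: "0 < L 2" using L(1)[of 2 3] L(2)[of 3] by simp
  show ?case
  proof (intro allI impI)
    fix i j assume ij: "i < n" "j < n"
    let ?I = "\<Sum>k\<in>{..<n} - {i, j}. L (torus_dist (x k) (x j))"
    \<comment> \<open>Only an inequality, because \<open>i = j\<close> is allowed and then a single
      node is removed.\<close>
    have "real n - 2 \<le> real (card ({..<n} - {i, j}))"
    proof -
      have "n - card {i, j} \<le> card ({..<n} - {i, j})"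
        using diff_card_le_card_Diff[of "{i, j}" "{..<n}"] by simp
      moreover have "card {i, j} \<le> 2" by (simp add: card_insert_if)
      ultimately show ?thesis by linarith
    qed
    then have "(real n - 2) * L 2 \<le> real (card ({..<n} - {i, j})) * L 2"
      using L2 by (intro mult_right_mono) auto
    also have "\<dots> = (\<Sum>k\<in>{..<n} - {i, j}. L 2)" by simp
    also have "\<dots> \<le> ?I"
    proof (rule sum_mono)
      fix k assume "k \<in> {..<n} - {i, j}"
      then have "torus_dist (x k) (x j) \<le> 2" using elim ij by (intro torus_dist_le_2) auto
      then show "L 2 \<le> L (torus_dist (x k) (x j))"
        using L(1)[of "torus_dist (x k) (x j)" 2] by (cases "torus_dist (x k) (x j) = 2") auto
    qed
    finally have "\<beta> * \<gamma> * ((real n - 2) * L 2) \<le> \<beta> * \<gamma> * ?I"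
      using pos by (intro mult_left_mono) auto
    moreover have "1 < \<beta> * \<gamma> * ((real n - 2) * L 2)"
      using n pos L2 by (simp add: field_simps)
    moreover have "0 \<le> \<beta> * (N0 / P0)" using pos(1,3) by (intro mult_nonneg_nonneg) simp_all
    ultimately have big: "1 < \<beta> * (N0 / P0 + \<gamma> * ?I)" by (simp add: algebra_simps)
    then have "0 < \<beta> * (N0 / P0 + \<gamma> * ?I)" by linarith
    then have "0 < N0 / P0 + \<gamma> * ?I" using pos(1) by (rule zero_less_mult_pos)
    moreover have "L (torus_dist (x i) (x j)) < \<beta> * (N0 / P0 + \<gamma> * ?I)"
      using big L(2)[of "torus_dist (x i) (x j)"] by simp
    ultimately have "sinr L N0 P0 \<gamma> n x i j < \<beta>"
      unfolding sinr_def by (simp only: pos_divide_less_eq)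
    then show "link_cap L N0 P0 \<gamma> \<beta> R n x i j = 0" by (simp add: link_cap_def)
  qed
qed

text \<open>\<open>K\<close>, \<open>M\<close> and \<open>N\<close> are chosen before the nodes and
  their numbers, so the constant hidden in the O-term is uniform in all of them, including the
  number of destinations. The mean is entered directly as the expected capacity of the cut of size
  0.\<close>

theorem theorem1:
  fixes L :: "real \<Rightarrow> real" and N0 P0 \<beta> \<gamma> R \<theta> :: real
  assumes "continuous_on {0..} L"
    and "\<And>x y. 0 \<le> x \<Longrightarrow> x < y \<Longrightarrow> L y < L x"
    and "\<And>x. 0 \<le> x \<Longrightarrow> 0 \<le> L x \<and> L x \<le> 1"
    and "N0 > 0" and "\<beta> > 0" and "0 \<le> \<gamma>" and "\<gamma> \<le> 1"
    and "P0 > \<beta> * N0"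
    and "0 < R" and "R \<le> 1"
    and "\<theta> > 0"
  shows "\<exists>K>0. \<exists>M N::nat. \<forall>n\<ge>N. \<forall>m\<ge>M. \<forall>s T U.
           s < n \<and> T \<subseteq> {..<n} \<and> U \<subseteq> {..<n} \<and> s \<notin> T \<and> s \<notin> U \<and> T \<inter> U = {}
           \<and> T \<noteq> {} \<and> card U = m \<longrightarrow>
           (let C = link_cap L N0 P0 \<gamma> \<beta> R n;
                EC0 = (\<integral>x. (\<Sum>u\<in>U. C x s u) \<partial>node_space n);
                eps = sqrt (2 * \<theta> * ln (real m) / EC0)
            in measure (node_space n)
                 {x \<in> space (node_space n). net_cap (C x) s T U \<ge> (1 - eps) * EC0}
               \<ge> 1 - K * real (card T) / real m powr \<theta>)"
proof -
  have P0: "0 < P0" using assms(4,5,8) by (smt (verit) mult_pos_pos)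
  have trivial: "1 - 3 * real (card T) / real m powr \<theta> \<le> measure (node_space n)
      {x \<in> space (node_space n). net_cap (link_cap L N0 P0 \<gamma> \<beta> R n x) s T U \<ge> (1 - eps) * EC0}"
    if "T \<subseteq> {..<n}" "U \<subseteq> {..<n}" "T \<noteq> {}" "EC0 = 0" for n m s :: nat and T U and eps EC0 :: real
    using that assms(9) finite_subset[OF _ finite_lessThan]
    by (intro prob_net_cap_ge_trivial) (auto simp: link_cap_def)
  show ?thesis
  proof (cases "\<gamma> = 0")
    case False
    obtain N where N: "1 / (\<beta> * \<gamma> * L 2) + 2 < real N" using reals_Archimedean2 by blast
    \<comment> \<open>\<open>M = 0\<close> is possible because the event has probability 1; at
      \<open>m = 0\<close> the error term divides by zero and is 0, which is still
      nonnegative.\<close>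
    show ?thesis
    proof (rule exI[of _ 3], rule conjI, simp, rule exI[of _ 0], rule exI[of _ N], intro allI impI, unfold Let_def, rule trivial)
      fix n m s :: nat and T U :: "nat set"
      assume n: "N \<le> n" and asm: "s < n \<and> T \<subseteq> {..<n} \<and> U \<subseteq> {..<n} \<and> s \<notin> T \<and> s \<notin> U \<and> T \<inter> U = {}
           \<and> T \<noteq> {} \<and> card U = m"
      have "AE x in node_space n. \<forall>i<n. \<forall>j<n. link_cap L N0 P0 \<gamma> \<beta> R n x i j = 0"
        using assms False P0 N n by (intro AE_link_cap_eq_0) auto
      then have "AE x in node_space n. (\<Sum>u\<in>U. link_cap L N0 P0 \<gamma> \<beta> R n x s u) = 0"
        by eventually_elim (use asm in \<open>auto intro!: sum.neutral\<close>)
      then show "(\<integral>x. (\<Sum>u\<in>U. link_cap L N0 P0 \<gamma> \<beta> R n x s u) \<partial>node_space n) = 0"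
        by (rule integral_eq_zero_AE)
    qed auto
  next
    case True
    \<comment> \<open>The distances at which a link exists when there is no interference. Continuity
      of \<open>L\<close> on the half-line makes \<open>D\<close> closed, hence Borel.\<close>
    define D where "D = {d \<in> {0..}. \<beta> * (N0 / P0) \<le> L d}"
    define p where "p = measure torus_unif {z. torus_dist (0, 0) z \<in> D}"
    have "closed D"
      unfolding D_def by (intro continuous_on_closed_Collect_le assms continuous_on_const) auto
    then have D: "D \<in> sets borel" by simp
    have C: "link_cap L N0 P0 \<gamma> \<beta> R n x = (\<lambda>i j. if torus_dist (x i) (x j) \<in> D then R else 0)" for n x
    proof (intro ext)
      fix i j
      have "\<beta> \<le> L (torus_dist (x i) (x j)) / (N0 / P0) \<longleftrightarrow> \<beta> * (N0 / P0) \<le> L (torus_dist (x i) (x j))"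
        using P0 assms(4) by (intro pos_le_divide_eq) simp
      then show "link_cap L N0 P0 \<gamma> \<beta> R n x i j = (if torus_dist (x i) (x j) \<in> D then R else 0)"
        unfolding link_cap_def sinr_def D_def True by simp
    qed
    have EC0: "(\<integral>x. (\<Sum>u\<in>U. link_cap L N0 P0 \<gamma> \<beta> R n x s u) \<partial>node_space n) = R * (real (card U) * p)"
      if "s < n" "U \<subseteq> {..<n}" "s \<notin> U" for n s U
      unfolding C p_def using that by (intro expected_star_capacity D)
    have "\<exists>M::nat. \<forall>n::nat. \<forall>m\<ge>M. \<forall>s T U. s < n \<and> T \<subseteq> {..<n} \<and> U \<subseteq> {..<n} \<and> s \<notin> U \<and> T \<inter> U = {}
      \<and> T \<noteq> {} \<and> card U = m \<longrightarrow>
      1 - 3 * real (card T) / real m powr \<theta> \<le> measure (node_space n) {x \<in> space (node_space n).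
        (1 - sqrt (2 * \<theta> * ln (real m) / (R * (real m * p)))) * (R * (real m * p))
          \<le> net_cap (link_cap L N0 P0 \<gamma> \<beta> R n x) s T U}"
    proof (cases "p = 0")
      case True
      then show ?thesis by (intro exI[of _ 0] allI impI trivial) auto
    next
      case False
      then have p: "0 < p" by (simp add: p_def zero_less_measure_iff)
      obtain d where d: "d \<in> D" "0 < d" using link_prob_pos_imp_radius[OF D] p by (auto simp: p_def)
      \<comment> \<open>As \<open>L\<close> decreases, \<open>D\<close> contains every shorter
        distance, so \<open>d\<close> serves as the radius within which all links are
        present.\<close>
      have "{0..d} \<subseteq> D"
      proof
        fix e assume "e \<in> {0..d}"
        then show "e \<in> D" using d(1) assms(2)[of e d] by (cases "e = d") (auto simp: D_def)
      qed
      then show ?thesis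
        unfolding C by (rule net_cap_concentration[OF D d(2) _ assms(9-11) p_def p])
    qed
    then obtain M :: nat where M: "\<forall>n::nat. \<forall>m\<ge>M. \<forall>s T U. s < n \<and> T \<subseteq> {..<n} \<and> U \<subseteq> {..<n} \<and> s \<notin> U \<and> T \<inter> U = {}
      \<and> T \<noteq> {} \<and> card U = m \<longrightarrow>
      1 - 3 * real (card T) / real m powr \<theta> \<le> measure (node_space n) {x \<in> space (node_space n).
        (1 - sqrt (2 * \<theta> * ln (real m) / (R * (real m * p)))) * (R * (real m * p))
          \<le> net_cap (link_cap L N0 P0 \<gamma> \<beta> R n x) s T U}" ..
    show ?thesis
    proof (rule exI[of _ 3], rule conjI, simp, rule exI[of _ M], rule exI[of _ 0], intro allI impI, unfold Let_def)
      fix n m s :: nat and T U :: "nat set"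
      assume m: "M \<le> m" and asm: "s < n \<and> T \<subseteq> {..<n} \<and> U \<subseteq> {..<n} \<and> s \<notin> T \<and> s \<notin> U \<and> T \<inter> U = {}
        \<and> T \<noteq> {} \<and> card U = m"
      have EC0_eq: "(\<integral>x. (\<Sum>u\<in>U. link_cap L N0 P0 \<gamma> \<beta> R n x s u) \<partial>node_space n) = R * (real m * p)"
        using EC0[of s n U] asm by simp
      show "1 - 3 * real (card T) / real m powr \<theta> \<le> measure (node_space n) {x \<in> space (node_space n).
        (1 - sqrt (2 * \<theta> * ln (real m) / (\<integral>x. (\<Sum>u\<in>U. link_cap L N0 P0 \<gamma> \<beta> R n x s u) \<partial>node_space n)))
          * (\<integral>x. (\<Sum>u\<in>U. link_cap L N0 P0 \<gamma> \<beta> R n x s u) \<partial>node_space n)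
        \<le> net_cap (link_cap L N0 P0 \<gamma> \<beta> R n x) s T U}"
        unfolding EC0_eq by (rule M[rule_format, OF m]) (use asm in blast)
    qed
  qed
qed

end
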